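(* Let $\mathsf{v}_n=\sum_{m=1}^{n}\frac{\pi}{m}$ for $n\in\mathbb{N}$, and let $H_{\infty}$ be the operator $-\frac{\mathrm{d}^2}{\mathrm{d}x^2}$ on $L^2(\mathbb{R}_+)$ with Dirichlet boundary conditions at all vertices of the infinite path graph over $\mathbb{R}_+$ with vertices $0,\mathsf{v}_1,\mathsf{v}_2,\dots$. Let $\lambda_1(\infty)\le\lambda_2(\infty)\le\dots$ be its eigenvalues counted with multiplicity and $(f_n^{\sigma=\infty})_{n\in\mathbb{N}}$ a corresponding orthonormal basis of eigenfunctions. For $N\in\mathbb{N}$ let $\lambda(N)$ be the function implicitly defined via the relation $N=\frac{\sqrt{\lambda}}{2}\ln\lambda$. Then for all $x\in(0,\infty)$ with $x\ne\mathsf{v}_n$ for every $n\in\mathbb{N}$, $$\lim_{N\to\infty}\frac{1}{\sqrt{\lambda(N)}}\sum_{n=1}^{N}|f_n^{\sigma=\infty}(x)|^2=\frac{1}{\pi}.$$ On the other hand, if $x=\mathsf{v}_k$ for some $k\in\mathbb{N}$, then the sum $\sum_{n=1}^{N}|f_n^{\sigma=\infty}(x)|^2$ is equal to zero (for every $N$).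
   Context: The operator $H_\infty$ is the $\sigma=\infty$ version of the Hamiltonian $H_\sigma=-\frac{\mathrm{d}^2}{\mathrm{d}x^2}+\sigma\sum_{n=1}^\infty\delta(x-\mathsf{v}_n)$ on $L^2(\mathbb{R}_+)$, where $\sigma=\infty$ means that Dirichlet boundary conditions are imposed in the vertices. That is, setting $\mathsf{v}_0=0$, $H_\infty$ is the direct sum over $n\ge1$ of the Dirichlet Laplacians $-\frac{\mathrm{d}^2}{\mathrm{d}x^2}$ on the intervals $(\mathsf{v}_{n-1},\mathsf{v}_n)$ of length $\pi/n$. It has purely discrete spectrum. Eigenfunctions are identified with their continuous representatives on $[0,\infty)$ (vanishing at all vertices). *)

theory Defs
  imports "HOL-Analysis.Analysis"
begin

definition vertex :: "nat \<Rightarrow> real" where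
  "vertex n = (\<Sum>m=1..n. pi / real m)"

text \<open>Elements of \<open>L\<^sup>2\<close> are represented by functions \<open>real \<Rightarrow> complex\<close>; only their values on the
  set \<open>A\<close> matter.\<close>

definition L2_on :: "real set \<Rightarrow> (real \<Rightarrow> complex) set" where
  "L2_on A = {f \<in> borel_measurable (lebesgue_on A).
                integrable (lebesgue_on A) (\<lambda>x. (cmod (f x))\<^sup>2)}"

definition L2_inner :: "real set \<Rightarrow> (real \<Rightarrow> complex) \<Rightarrow> (real \<Rightarrow> complex) \<Rightarrow> complex" where
  "L2_inner A f g = (LINT x|lebesgue_on A. cnj (f x) * g x)"

definition L2_dist :: "real set \<Rightarrow> (real \<Rightarrow> complex) \<Rightarrow> (real \<Rightarrow> complex) \<Rightarrow> real" where
  "L2_dist A f g = sqrt (LINT x|lebesgue_on A. (cmod (f x - g x))\<^sup>2)"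

text \<open>Families are indexed by the positive integers; totality is density of the linear span.\<close>

definition orthonormal_basis_L2 :: "real set \<Rightarrow> (nat \<Rightarrow> real \<Rightarrow> complex) \<Rightarrow> bool" where
  "orthonormal_basis_L2 A f \<longleftrightarrow>
     (\<forall>n\<ge>1. f n \<in> L2_on A) \<and>
     (\<forall>m\<ge>1. \<forall>n\<ge>1. L2_inner A (f m) (f n) = (if m = n then 1 else 0)) \<and>
     (\<forall>g\<in>L2_on A. \<forall>e>0. \<exists>M c. L2_dist A g (\<lambda>x. \<Sum>n=1..M. c n * f n x) < e)"

text \<open>\<open>H1_deriv a b u u'\<close>: on \<open>[a,b]\<close>, \<open>u\<close> is the (absolutely) continuous representative of an element
  of the Sobolev space \<open>H\<^sup>1(a,b)\<close> and \<open>u'\<close> is its weak derivative (determined almost everywhere).\<close>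

definition H1_deriv :: "real \<Rightarrow> real \<Rightarrow> (real \<Rightarrow> complex) \<Rightarrow> (real \<Rightarrow> complex) \<Rightarrow> bool" where
  "H1_deriv a b u u' \<longleftrightarrow>
     u' \<in> L2_on {a..b} \<and> (\<forall>x\<in>{a..b}. u x = u a + (LINT t|lebesgue_on {a..x}. u' t))"

text \<open>Graph of the Dirichlet Laplacian \<open>- d\<^sup>2/dx\<^sup>2\<close> on \<open>(a,b)\<close>: its domain consists of the \<open>u\<close> in
  \<open>H\<^sup>2(a,b)\<close> with \<open>u(a) = u(b) = 0\<close>, and \<open>g\<close> is the image of \<open>u\<close>.\<close>

definition dirichlet_laplacian ::
    "real \<Rightarrow> real \<Rightarrow> (real \<Rightarrow> complex) \<Rightarrow> (real \<Rightarrow> complex) \<Rightarrow> bool" where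
  "dirichlet_laplacian a b u g \<longleftrightarrow>
     u a = 0 \<and> u b = 0 \<and> (\<exists>u'. H1_deriv a b u u' \<and> H1_deriv a b u' (\<lambda>x. - g x))"

text \<open>Graph of the orthogonal direct sum of the Dirichlet Laplacians on the edges. Elements \<open>u\<close> of the
  domain are given by their continuous representatives on the closed half-line, which vanish at
  every vertex.\<close>

definition H_infinity :: "(real \<Rightarrow> complex) \<Rightarrow> (real \<Rightarrow> complex) \<Rightarrow> bool" where
  "H_infinity u g \<longleftrightarrow>
     u \<in> L2_on {0..} \<and> g \<in> L2_on {0..} \<and>
     (\<forall>n\<ge>1. dirichlet_laplacian (vertex (n - 1)) (vertex n) u g)"

text \<open>A non-decreasing sequence of eigenvalues with a corresponding orthonormal basis of eigenfunctions;
  since the basis is total, every eigenvalue occurs in the sequence as often as its multiplicity.\<close>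

definition ordered_eigenbasis_H_infinity :: "(nat \<Rightarrow> real) \<Rightarrow> (nat \<Rightarrow> real \<Rightarrow> complex) \<Rightarrow> bool" where
  "ordered_eigenbasis_H_infinity ev f \<longleftrightarrow>
     mono_on {1..} ev \<and>
     (\<forall>n\<ge>1. H_infinity (f n) (\<lambda>x. complex_of_real (ev n) * f n x)) \<and>
     orthonormal_basis_L2 {0..} f"

definition lambda_of :: "nat \<Rightarrow> real" where
  "lambda_of N = (THE l. l > 0 \<and> real N = sqrt l / 2 * ln l)"

lemma lambda_of_ex1: "\<exists>!l. l > 0 \<and> real N = sqrt l / 2 * ln l"
proof -
  let ?h = "\<lambda>l::real. sqrt l / 2 * ln l"
  let ?b = "exp (2 * (real N + 1)) :: real"
  have ge1: "l \<ge> 1" if "l > 0" "real N = ?h l" for l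
  proof (rule ccontr)
    assume "\<not> l \<ge> 1"
    then have "ln l < 0" using that by simp
    then have "?h l < 0" using that by (simp add: mult_pos_neg)
    then show False using that by linarith
  qed
  have less: "?h k < ?h l" if "1 \<le> k" "k < l" for k l
  proof (rule mult_strict_mono)
    show "sqrt k / 2 < sqrt l / 2" using that by simp
    show "ln k < ln l" using that by simp
    show "0 < sqrt l / 2" using that by simp
    show "0 \<le> ln k" using that by simp
  qed
  have "sqrt ?b = exp (real N + 1)"
    by (rule real_sqrt_unique) (simp_all add: exp_double[symmetric] mult.commute)
  then have "?h ?b = exp (real N + 1) * (real N + 1)" by simp
  also have "\<dots> \<ge> 1 * (real N + 1)"
    by (intro mult_right_mono) (simp_all add: one_le_exp_iff)
  finally have hb: "?h ?b \<ge> real N" by simp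
  have "\<exists>l\<ge>1. l \<le> ?b \<and> ?h l = real N"
  proof (rule IVT')
    show "?h 1 \<le> real N" by simp
    show "real N \<le> ?h ?b" by (rule hb)
    show "1 \<le> ?b" by (simp add: one_le_exp_iff)
    show "continuous_on {1..?b} ?h" by (intro continuous_intros) auto
  qed
  then obtain l where l: "l \<ge> 1" "?h l = real N" by blast
  show ?thesis
  proof (rule ex1I[of _ l])
    show "l > 0 \<and> real N = ?h l" using l by simp
    fix k assume k: "k > 0 \<and> real N = ?h k"
    then have "k \<ge> 1" using ge1 by blast
    then show "k = l" using less[of k l] less[of l k] l k by linarith
  qed
qed

end

theory Submission
  imports Defs
begin

text \<open>
On the edge of length \<open>pi / j\<close> the Dirichlet eigenvalues are \<open>(k j)\<^sup>2\<close> with eigenfunctions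
\<open>sin (k j (x - v))\<close>, where \<open>v\<close> is the left end of the edge. So the eigenvalues of the direct sum are
the squares \<open>m\<^sup>2\<close>, and the eigenspace of \<open>m\<^sup>2\<close> has one mode on each edge whose index divides \<open>m\<close>;
its dimension is the number of divisors of \<open>m\<close>.

The choice of the basis inside the eigenspaces changes the sums by bounded errors only. To see this, expand the given eigenfunctions in edge modes and consider the matrix of their coefficients. Rows are
normalised because the basis is orthonormal (\<open>coef_normalised\<close>), columns because of Parseval's identity
for the edge modes (\<open>coef_has_sum\<close>). Double counting the squares of the entries gives the multiplicity
(\<open>card_level\<close>), and a single column gives the sum of \<open>\<bar>f n x\<bar>\<^sup>2\<close> over an eigenspace
(\<open>level_square_sum\<close>): for \<open>x\<close> in edge \<open>j\<close> it is \<open>(2 j / pi) (sin (m (x - v)))\<^sup>2\<close> if \<open>j\<close> divides \<open>m\<close>,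
and zero otherwise.

Summing over all \<open>m \<le> M\<close> leaves about \<open>M / j\<close> terms whose sine squares average to one half, so the
result is \<open>M / pi + O(1)\<close>, independently of the edge (\<open>edge_density_sum\<close>). Here it matters that \<open>x\<close> is not
a vertex: the phase \<open>j (x - v)\<close> then lies strictly between 0 and \<open>pi\<close>.

It remains to compare \<open>M = freq N\<close>, the square root of the \<open>N\<close>-th eigenvalue, with
\<open>s = sqrt (lambda_of N)\<close>, which solves \<open>s ln s = N\<close>. Counting multiplicities, \<open>N\<close> is the summatory
function of the number of divisors up to an error within one level, hence \<open>N = M ln M + O(M)\<close>
(\<open>index_vs_frequency\<close>). As \<open>s ln s\<close> and \<open>M ln M\<close> differ by \<open>O(M)\<close> only, \<open>s / M\<close> differs from 1 by
\<open>O(1 / ln M)\<close> (\<open>x_ln_x_gap\<close>), and the limit follows.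
\<close>

section \<open>Parseval's identity in \<open>L\<^sup>2\<close>\<close>

lemma L2_on_product_integrable:
  assumes "g \<in> L2_on A" "h \<in> L2_on A"
  shows "integrable (lebesgue_on A) (\<lambda>x. cnj (g x) * h x)"
proof (rule Bochner_Integration.integrable_bound)
  show "integrable (lebesgue_on A) (\<lambda>x. (cmod (g x))\<^sup>2 + (cmod (h x))\<^sup>2)"
    using assms by (auto simp: L2_on_def)
  have "g \<in> borel_measurable (lebesgue_on A)" "h \<in> borel_measurable (lebesgue_on A)"
    using assms by (auto simp: L2_on_def)
  moreover from this(1) have "(\<lambda>x. cnj (g x)) \<in> borel_measurable (lebesgue_on A)"
    by (rule borel_measurable_continuous_on[OF continuous_on_cnj[OF continuous_on_id]])
  ultimately show "(\<lambda>x. cnj (g x) * h x) \<in> borel_measurable (lebesgue_on A)"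
    by measurable
  have "norm (cnj a * b) \<le> norm ((cmod a)\<^sup>2 + (cmod b)\<^sup>2)" for a b :: complex
  proof -
    have "2 * (cmod a * cmod b) \<le> (cmod a)\<^sup>2 + (cmod b)\<^sup>2"
      using sum_squares_bound[of "cmod a" "cmod b"] by (simp add: mult.assoc)
    moreover have "0 \<le> cmod a * cmod b" by simp
    ultimately have "cmod a * cmod b \<le> (cmod a)\<^sup>2 + (cmod b)\<^sup>2" by linarith
    then show ?thesis by (simp add: norm_mult)
  qed
  then show "AE x in lebesgue_on A. norm (cnj (g x) * h x) \<le> norm ((cmod (g x))\<^sup>2 + (cmod (h x))\<^sup>2)"
    by blast
qed

lemma L2_on_scale: "g \<in> L2_on A \<Longrightarrow> (\<lambda>x. c * g x) \<in> L2_on A"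
  by (auto simp: L2_on_def norm_mult power_mult_distrib)

lemma L2_on_add:
  assumes "g \<in> L2_on A" "h \<in> L2_on A"
  shows "(\<lambda>x. g x + h x) \<in> L2_on A"
proof -
  have m: "(\<lambda>x. g x + h x) \<in> borel_measurable (lebesgue_on A)"
    using assms by (auto simp: L2_on_def)
  have "integrable (lebesgue_on A) (\<lambda>x. (cmod (g x + h x))\<^sup>2)"
  proof (rule Bochner_Integration.integrable_bound)
    show "integrable (lebesgue_on A) (\<lambda>x. 2 * (cmod (g x))\<^sup>2 + 2 * (cmod (h x))\<^sup>2)"
      using assms by (auto simp: L2_on_def)
    show "(\<lambda>x. (cmod (g x + h x))\<^sup>2) \<in> borel_measurable (lebesgue_on A)"
      using m by measurable
    have "(cmod (a + b))\<^sup>2 \<le> 2 * (cmod a)\<^sup>2 + 2 * (cmod b)\<^sup>2" for a b :: complex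
    proof -
      have "(cmod (a + b))\<^sup>2 \<le> (cmod a + cmod b)\<^sup>2"
        by (intro power_mono norm_triangle_ineq) simp
      also have "\<dots> \<le> 2 * (cmod a)\<^sup>2 + 2 * (cmod b)\<^sup>2"
        using sum_squares_bound[of "cmod a" "cmod b"] by (simp add: power2_sum)
      finally show ?thesis .
    qed
    then show "AE x in lebesgue_on A. norm ((cmod (g x + h x))\<^sup>2)
        \<le> norm (2 * (cmod (g x))\<^sup>2 + 2 * (cmod (h x))\<^sup>2)"
      by simp
  qed
  with m show ?thesis by (simp add: L2_on_def)
qed

lemma L2_on_sum:
  assumes "finite F" "\<And>n. n \<in> F \<Longrightarrow> g n \<in> L2_on A"
  shows "(\<lambda>x. \<Sum>n\<in>F. c n * g n x) \<in> L2_on A"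
  using assms
proof (induction F)
  case empty
  then show ?case by (simp add: L2_on_def)
next
  case (insert n F)
  then show ?case using L2_on_add[OF L2_on_scale[of "g n" A "c n"]] by simp
qed

lemma L2_inner_cong:
  assumes "\<And>x. x \<in> A \<Longrightarrow> g x = g' x" "\<And>x. x \<in> A \<Longrightarrow> h x = h' x"
  shows "L2_inner A g h = L2_inner A g' h'"
  unfolding L2_inner_def by (rule Bochner_Integration.integral_cong) (auto simp: assms)

lemma L2_inner_sum_right:
  assumes "finite F" "g \<in> L2_on A" "\<And>n. n \<in> F \<Longrightarrow> h n \<in> L2_on A"
  shows "L2_inner A g (\<lambda>x. \<Sum>n\<in>F. c n * h n x) = (\<Sum>n\<in>F. c n * L2_inner A g (h n))"
proof -
  have "L2_inner A g (\<lambda>x. \<Sum>n\<in>F. c n * h n x)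
      = (LINT x|lebesgue_on A. (\<Sum>n\<in>F. c n * (cnj (g x) * h n x)))"
    unfolding L2_inner_def by (simp add: sum_distrib_left mult_ac)
  also have "\<dots> = (\<Sum>n\<in>F. LINT x|lebesgue_on A. c n * (cnj (g x) * h n x))"
    by (rule Bochner_Integration.integral_sum)
       (use assms L2_on_product_integrable in auto)
  finally show ?thesis by (simp add: L2_inner_def)
qed

lemma L2_inner_diff_right:
  assumes "g \<in> L2_on A" "h \<in> L2_on A" "k \<in> L2_on A"
  shows "L2_inner A g (\<lambda>x. h x - k x) = L2_inner A g h - L2_inner A g k"
  unfolding L2_inner_def
  by (simp add: right_diff_distrib Bochner_Integration.integral_diff L2_on_product_integrable assms)

lemma L2_inner_cnj: "cnj (L2_inner A g h) = L2_inner A h g"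
  unfolding L2_inner_def by (simp add: mult.commute flip: Bochner_Integration.integral_cnj)

lemma L2_inner_diff_left:
  assumes "g \<in> L2_on A" "h \<in> L2_on A" "k \<in> L2_on A"
  shows "L2_inner A (\<lambda>x. h x - k x) g = L2_inner A h g - L2_inner A k g"
  using arg_cong[OF L2_inner_diff_right[OF assms], of cnj] by (simp add: L2_inner_cnj)

lemma L2_inner_sum_left:
  assumes "finite F" "g \<in> L2_on A" "\<And>n. n \<in> F \<Longrightarrow> h n \<in> L2_on A"
  shows "L2_inner A (\<lambda>x. \<Sum>n\<in>F. c n * h n x) g = (\<Sum>n\<in>F. cnj (c n) * L2_inner A (h n) g)"
  by (subst L2_inner_cnj[symmetric], subst L2_inner_sum_right) (simp_all add: assms L2_inner_cnj)

lemma L2_inner_self: "L2_inner A g g = of_real (LINT x|lebesgue_on A. (cmod (g x))\<^sup>2)"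
proof -
  have "L2_inner A g g = (LINT x|lebesgue_on A. complex_of_real ((cmod (g x))\<^sup>2))"
    unfolding L2_inner_def by (metis complex_norm_square mult.commute)
  then show ?thesis by (simp only: integral_complex_of_real)
qed

lemma L2_dist_square: "of_real ((L2_dist A g h)\<^sup>2) = L2_inner A (\<lambda>x. g x - h x) (\<lambda>x. g x - h x)"
  by (simp add: L2_inner_self L2_dist_def)

text \<open>Completing the square: the squared distance to a combination is the squared distance to the
orthogonal projection plus the error of the coefficients, so no choice of coefficients does better
than the Fourier coefficients.\<close>

lemma L2_dist_orthonormal_combination:
  assumes "finite F" and g: "g \<in> L2_on A" and f: "\<And>n. n \<in> F \<Longrightarrow> f n \<in> L2_on A"
    and orth: "\<And>m n. m \<in> F \<Longrightarrow> n \<in> F \<Longrightarrow> L2_inner A (f m) (f n) = (if m = n then 1 else 0)"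
  shows "(L2_dist A g (\<lambda>x. \<Sum>n\<in>F. c n * f n x))\<^sup>2
    = Re (L2_inner A g g) - (\<Sum>n\<in>F. (cmod (L2_inner A (f n) g))\<^sup>2)
      + (\<Sum>n\<in>F. (cmod (c n - L2_inner A (f n) g))\<^sup>2)"
proof -
  let ?a = "\<lambda>n. L2_inner A (f n) g"
  have square: "Re (cnj b * b - cnj b * a - b * cnj a) = (cmod (b - a))\<^sup>2 - (cmod a)\<^sup>2" for a b
    by (simp add: cmod_power2) (simp add: power2_eq_square algebra_simps)
  define s where "s = (\<lambda>x. \<Sum>n\<in>F. c n * f n x)"
  have s: "s \<in> L2_on A" unfolding s_def by (intro L2_on_sum assms)
  have d: "(\<lambda>x. g x - s x) \<in> L2_on A"
    using L2_on_add[OF g L2_on_scale[OF s, of "-1"]] by simp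
  have gs: "L2_inner A g s = (\<Sum>n\<in>F. c n * cnj (?a n))"
    unfolding s_def by (subst L2_inner_sum_right) (simp_all add: assms L2_inner_cnj)
  have fs: "L2_inner A (f m) s = c m" if "m \<in> F" for m
  proof -
    have "L2_inner A (f m) s = (\<Sum>n\<in>F. c n * L2_inner A (f m) (f n))"
      unfolding s_def by (rule L2_inner_sum_right) (use assms that in auto)
    also have "\<dots> = (\<Sum>n\<in>F. if m = n then c n else 0)"
      by (rule sum.cong) (use orth that in auto)
    finally show ?thesis using assms(1) that by simp
  qed
  have ss: "L2_inner A s s = (\<Sum>n\<in>F. cnj (c n) * c n)"
    by (subst s_def, subst L2_inner_sum_left[OF assms(1) s f]) (simp_all add: fs)
  have sg: "L2_inner A s g = (\<Sum>n\<in>F. cnj (c n) * ?a n)"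
    unfolding s_def by (rule L2_inner_sum_left) (simp_all add: assms)
  have "L2_inner A (\<lambda>x. g x - s x) (\<lambda>x. g x - s x)
      = L2_inner A g g - (\<Sum>n\<in>F. cnj (c n) * ?a n)
      - (\<Sum>n\<in>F. c n * cnj (?a n)) + (\<Sum>n\<in>F. cnj (c n) * c n)"
    by (simp add: L2_inner_diff_right L2_inner_diff_left d g s ss gs sg)
  then have "of_real ((L2_dist A g s)\<^sup>2) = L2_inner A g g - (\<Sum>n\<in>F. cnj (c n) * ?a n)
      - (\<Sum>n\<in>F. c n * cnj (?a n)) + (\<Sum>n\<in>F. cnj (c n) * c n)"
    by (simp only: L2_dist_square)
  also have "\<dots> = L2_inner A g g
      + (\<Sum>n\<in>F. cnj (c n) * c n - cnj (c n) * ?a n - c n * cnj (?a n))"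
    by (simp only: sum_subtractf) simp
  finally have "(L2_dist A g s)\<^sup>2 = Re (L2_inner A g g
      + (\<Sum>n\<in>F. cnj (c n) * c n - cnj (c n) * ?a n - c n * cnj (?a n)))"
    by (metis Re_complex_of_real)
  also have "\<dots> = Re (L2_inner A g g)
      + (\<Sum>n\<in>F. Re (cnj (c n) * c n - cnj (c n) * ?a n - c n * cnj (?a n)))"
    by (simp only: Re_sum plus_complex.sel)
  also have "\<dots> = Re (L2_inner A g g)
      + (\<Sum>n\<in>F. (cmod (c n - ?a n))\<^sup>2 - (cmod (?a n))\<^sup>2)"
    by (simp only: square)
  finally show ?thesis by (simp add: s_def sum_subtractf)
qed

text \<open>Totality only provides, for each \<open>e\<close>, some combination close to \<open>g\<close>. By the preceding formula,
replacing its coefficients by Fourier coefficients and enlarging the index set both decrease the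
distance, and the distance then is exactly the defect in Parseval's identity.\<close>

lemma parseval:
  assumes B: "orthonormal_basis_L2 A f" and g: "g \<in> L2_on A"
  shows "((\<lambda>n. (cmod (L2_inner A (f n) g))\<^sup>2) has_sum Re (L2_inner A g g)) {1..}"
proof -
  let ?a = "\<lambda>n. L2_inner A (f n) g"
  have formula: "(L2_dist A g (\<lambda>x. \<Sum>n\<in>F. c n * f n x))\<^sup>2
    = Re (L2_inner A g g) - (\<Sum>n\<in>F. (cmod (?a n))\<^sup>2) + (\<Sum>n\<in>F. (cmod (c n - ?a n))\<^sup>2)"
    if "finite F" "F \<subseteq> {1..}" for F c
    by (rule L2_dist_orthonormal_combination)
       (use that B g in \<open>auto simp: orthonormal_basis_L2_def subset_iff\<close>)
  show ?thesis
    unfolding has_sum_def tendsto_iff eventually_finite_subsets_at_top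
  proof (intro allI impI)
    fix e :: real assume "e > 0"
    \<comment> \<open>the distance enters squared, so it must be made smaller than \<open>sqrt e\<close>\<close>
    then have "sqrt e > 0" by simp
    then obtain M c where Mc: "L2_dist A g (\<lambda>x. \<Sum>n=1..M. c n * f n x) < sqrt e"
      using B g unfolding orthonormal_basis_L2_def by blast
    have "(L2_dist A g (\<lambda>x. \<Sum>n=1..M. c n * f n x))\<^sup>2 < (sqrt e)\<^sup>2"
      by (rule power_strict_mono[OF Mc]) (auto simp: L2_dist_def)
    moreover have "(L2_dist A g (\<lambda>x. \<Sum>n=1..M. c n * f n x))\<^sup>2
      \<ge> Re (L2_inner A g g) - (\<Sum>n=1..M. (cmod (?a n))\<^sup>2)"
      by (subst formula) (auto intro: sum_nonneg)
    ultimately have lower: "Re (L2_inner A g g) - (\<Sum>n=1..M. (cmod (?a n))\<^sup>2) < e"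
      using \<open>e > 0\<close> by simp
    show "\<exists>X. finite X \<and> X \<subseteq> {1..} \<and> (\<forall>Y. finite Y \<and> X \<subseteq> Y \<and> Y \<subseteq> {1..} \<longrightarrow>
       dist (\<Sum>n\<in>Y. (cmod (?a n))\<^sup>2) (Re (L2_inner A g g)) < e)"
    proof (intro exI[of _ "{1..M}"] conjI allI impI)
      fix Y assume Y: "finite Y \<and> {1..M} \<subseteq> Y \<and> Y \<subseteq> {1..}"
      then have "(\<Sum>n=1..M. (cmod (?a n))\<^sup>2) \<le> (\<Sum>n\<in>Y. (cmod (?a n))\<^sup>2)"
        by (intro sum_mono2) auto
      moreover have "(\<Sum>n\<in>Y. (cmod (?a n))\<^sup>2) \<le> Re (L2_inner A g g)"
        using formula[of Y ?a] Y zero_le_power2[of "L2_dist A g (\<lambda>x. \<Sum>n\<in>Y. ?a n * f n x)"] by simp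
      ultimately show "dist (\<Sum>n\<in>Y. (cmod (?a n))\<^sup>2) (Re (L2_inner A g g)) < e"
        using lower by (simp add: dist_real_def)
    qed auto
  qed
qed

section \<open>Dirichlet eigenfunctions on an interval\<close>

lemma L2_on_interval_integrable:
  assumes "g \<in> L2_on {a..b}"
  shows "integrable (lebesgue_on {a..b}) g"
proof -
  have "integrable (lebesgue_on {a..b}) (\<lambda>x. 1::real)"
    by (rule continuous_imp_integrable_real) simp
  then have "(\<lambda>_. 1) \<in> L2_on {a..b}" by (simp add: L2_on_def)
  from L2_on_product_integrable[OF this assms] show ?thesis by simp
qed

lemma H1_deriv_eq_integral:
  assumes "H1_deriv a b u u'" "x \<in> {a..b}"
  shows "u x = u a + integral {a..x} u'"
proof -
  have "integrable (lebesgue_on {a..b}) u'"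
    using assms(1) L2_on_interval_integrable by (simp add: H1_deriv_def)
  then have "integrable (lebesgue_on {a..x}) u'"
    by (rule Equivalence_Lebesgue_Henstock_Integration.integrable_subinterval) (use assms(2) in auto)
  then have "(LINT t|lebesgue_on {a..x}. u' t) = integral {a..x} u'"
    by (rule lebesgue_integral_eq_integral) simp
  moreover have "u x = u a + (LINT t|lebesgue_on {a..x}. u' t)"
    using assms unfolding H1_deriv_def by blast
  ultimately show ?thesis by simp
qed

lemma H1_deriv_continuous_on:
  assumes "H1_deriv a b u u'"
  shows "continuous_on {a..b} u"
proof -
  have "u' integrable_on {a..b}"
    using assms L2_on_interval_integrable by (auto simp: H1_deriv_def intro: integrable_on_lebesgue_on)
  then have "continuous_on {a..b} (\<lambda>x. u a + integral {a..x} u')"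
    by (intro continuous_intros indefinite_integral_continuous_1)
  then show ?thesis
    by (rule continuous_on_eq) (rule H1_deriv_eq_integral[OF assms, symmetric])
qed

text \<open>This turns the weak equation into a classical one: for an eigenfunction, the weak derivative is itself
an indefinite integral, hence continuous, and its own weak derivative is a multiple of the
continuous function \<open>u\<close>.\<close>

lemma H1_deriv_has_vector_derivative:
  assumes "H1_deriv a b u u'" "continuous_on {a..b} u'" "x \<in> {a..b}"
  shows "(u has_vector_derivative u' x) (at x within {a..b})"
proof (rule has_vector_derivative_transform[OF assms(3)])
  show "u y = u a + integral {a..y} u'" if "y \<in> {a..b}" for y
    by (rule H1_deriv_eq_integral[OF assms(1) that])
  show "((\<lambda>y. u a + integral {a..y} u') has_vector_derivative u' x) (at x within {a..b})"
    using has_vector_derivative_add[OF has_vector_derivative_const integral_has_vector_derivative[OF assms(2,3)]] by simp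
qed

lemma constant_on_interval_if_zero_derivative:
  fixes h :: "real \<Rightarrow> 'a::real_normed_vector"
  assumes "\<And>x. x \<in> {a..b} \<Longrightarrow> (h has_vector_derivative 0) (at x within {a..b})" "x \<in> {a..b}"
  shows "h x = h a"
proof -
  obtain c where "\<And>x. x \<in> {a..b} \<Longrightarrow> h x = c"
    using has_vector_derivative_zero_constant[of "{a..b}" h] assms(1) by auto
  then show ?thesis using assms(2) by auto
qed

text \<open>An energy argument excludes \<open>l \<le> 0\<close>: the function \<open>W = u \<bullet> u'\<close> has derivative
\<open>\<bar>u'\<bar>\<^sup>2 - l \<bar>u\<bar>\<^sup>2 \<ge> 0\<close> and vanishes at both ends, so it vanishes throughout; but \<open>2 W\<close> is the
derivative of \<open>\<bar>u\<bar>\<^sup>2\<close>, which is therefore constantly zero.\<close>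

lemma dirichlet_nonpositive_eigenvalue:
  fixes u u' :: "real \<Rightarrow> complex" and l :: real
  assumes "u a = 0" "u b = 0" "l \<le> 0"
    and u: "\<And>x. x \<in> {a..b} \<Longrightarrow> (u has_vector_derivative u' x) (at x within {a..b})"
    and u': "\<And>x. x \<in> {a..b} \<Longrightarrow> (u' has_vector_derivative - (of_real l * u x)) (at x within {a..b})"
    and x: "x \<in> {a..b}"
  shows "u x = 0"
proof -
  define W where "W = (\<lambda>x. u x \<bullet> u' x)"
  have W: "(W has_real_derivative (norm (u' x))\<^sup>2 - l * (norm (u x))\<^sup>2) (at x within {a..b})"
    if "x \<in> {a..b}" for x
  proof -
    have "(W has_vector_derivative u x \<bullet> - (of_real l * u x) + u' x \<bullet> u' x) (at x within {a..b})"
      unfolding W_def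
      using bounded_bilinear.has_vector_derivative[OF bounded_bilinear_inner u[OF that] u'[OF that]] .
    also have "u x \<bullet> - (of_real l * u x) + u' x \<bullet> u' x = (norm (u' x))\<^sup>2 - l * (norm (u x))\<^sup>2"
      by (simp add: power2_norm_eq_inner flip: scaleR_conv_of_real)
    finally show ?thesis by (simp add: has_real_derivative_iff_has_vector_derivative)
  qed
  have mono: "W y \<le> W z" if "y \<in> {a..b}" "z \<in> {a..b}" "y \<le> z" for y z
  proof (rule DERIV_nonneg_imp_increasing_open[OF that(3)])
    fix t assume t: "y < t" "t < z"
    then have "(W has_real_derivative (norm (u' t))\<^sup>2 - l * (norm (u t))\<^sup>2) (at t)"
      using W[of t] that at_within_Icc_at[of a t b] by simp
    moreover have "(norm (u' t))\<^sup>2 - l * (norm (u t))\<^sup>2 \<ge> 0"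
      using \<open>l \<le> 0\<close> by (simp add: mult_nonpos_nonneg order_trans[OF _ zero_le_power2])
    ultimately show "\<exists>d. (W has_real_derivative d) (at t) \<and> d \<ge> 0" by blast
  next
    have "continuous_on {a..b} W"
      by (rule DERIV_continuous_on[OF W])
    then show "continuous_on {y..z} W" by (rule continuous_on_subset) (use that in auto)
  qed
  have W0: "W y = 0" if "y \<in> {a..b}" for y
    using mono[of a y] mono[of y b] that assms(1,2) by (simp add: W_def)
  have "u x \<bullet> u x = u a \<bullet> u a"
  proof (rule constant_on_interval_if_zero_derivative[OF _ x])
    fix y assume y: "y \<in> {a..b}"
    have "((\<lambda>y. u y \<bullet> u y) has_vector_derivative u y \<bullet> u' y + u' y \<bullet> u y) (at y within {a..b})"
      using bounded_bilinear.has_vector_derivative[OF bounded_bilinear_inner u[OF y] u[OF y]] .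
    then show "((\<lambda>y. u y \<bullet> u y) has_vector_derivative 0) (at y within {a..b})"
      using W0[OF y] by (simp add: W_def inner_commute)
  qed
  then show ?thesis using assms(1) by simp
qed

text \<open>In the phase plane, the equation \<open>u'' = - s\<^sup>2 u\<close> rotates the vector \<open>(s u, u')\<close> with angular speed
\<open>s\<close>. Rotating back gives two quantities \<open>P\<close> and \<open>Q\<close> that do not depend on \<open>x\<close>; their values at \<open>a\<close>
determine \<open>u\<close>.\<close>

lemma dirichlet_positive_eigenvalue:
  fixes u u' :: "real \<Rightarrow> complex" and s :: real
  assumes "u a = 0" "s > 0"
    and u: "\<And>x. x \<in> {a..b} \<Longrightarrow> (u has_vector_derivative u' x) (at x within {a..b})"
    and u': "\<And>x. x \<in> {a..b} \<Longrightarrow> (u' has_vector_derivative - (s\<^sup>2 *\<^sub>R u x)) (at x within {a..b})"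
    and x: "x \<in> {a..b}"
  shows "u x = u' a / of_real s * of_real (sin (s * (x - a)))"
proof -
  define C where "C = (\<lambda>x. cos (s * (x - a)))"
  define S where "S = (\<lambda>x. sin (s * (x - a)))"
  have C: "(C has_real_derivative - (s * S y)) (at y within {a..b})" for y
    unfolding C_def S_def by (auto intro!: derivative_eq_intros)
  have S: "(S has_real_derivative s * C y) (at y within {a..b})" for y
    unfolding C_def S_def by (auto intro!: derivative_eq_intros)
  define P where "P = (\<lambda>x. s *\<^sub>R (C x *\<^sub>R u x) - S x *\<^sub>R u' x)"
  define Q where "Q = (\<lambda>x. s *\<^sub>R (S x *\<^sub>R u x) + C x *\<^sub>R u' x)"
  have P: "P x = P a"
  proof (rule constant_on_interval_if_zero_derivative[OF _ x])
    fix y assume y: "y \<in> {a..b}"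
    have "(P has_vector_derivative s *\<^sub>R (C y *\<^sub>R u' y + (- (s * S y)) *\<^sub>R u y)
        - (S y *\<^sub>R (- (s\<^sup>2 *\<^sub>R u y)) + (s * C y) *\<^sub>R u' y)) (at y within {a..b})"
      unfolding P_def
      by (intro has_vector_derivative_diff has_vector_derivative_scaleR C S u[OF y] u'[OF y]
          bounded_linear.has_vector_derivative[OF bounded_linear_scaleR_right])
    then show "(P has_vector_derivative 0) (at y within {a..b})"
      by (simp add: scaleR_add_right scaleR_diff_right power2_eq_square mult_ac)
  qed
  have Q: "Q x = Q a"
  proof (rule constant_on_interval_if_zero_derivative[OF _ x])
    fix y assume y: "y \<in> {a..b}"
    have "(Q has_vector_derivative s *\<^sub>R (S y *\<^sub>R u' y + (s * C y) *\<^sub>R u y)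
        + (C y *\<^sub>R (- (s\<^sup>2 *\<^sub>R u y)) + (- (s * S y)) *\<^sub>R u' y)) (at y within {a..b})"
      unfolding Q_def
      by (intro has_vector_derivative_add has_vector_derivative_scaleR C S u[OF y] u'[OF y]
          bounded_linear.has_vector_derivative[OF bounded_linear_scaleR_right])
    then show "(Q has_vector_derivative 0) (at y within {a..b})"
      by (simp add: scaleR_add_right power2_eq_square mult_ac)
  qed
  have "C x *\<^sub>R P x + S x *\<^sub>R Q x = (((C x)\<^sup>2 + (S x)\<^sup>2) * s) *\<^sub>R u x"
    unfolding P_def Q_def
    by (simp add: scaleR_add_right scaleR_diff_right scaleR_add_left power2_eq_square mult_ac distrib_left)
  moreover have "(C x)\<^sup>2 + (S x)\<^sup>2 = 1" by (simp add: C_def S_def)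
  moreover have "P a = 0" "Q a = u' a" by (simp_all add: P_def Q_def C_def S_def \<open>u a = 0\<close>)
  ultimately have "s *\<^sub>R u x = S x *\<^sub>R u' a" using P Q by simp
  then show ?thesis using \<open>s > 0\<close> by (simp add: scaleR_conv_of_real S_def field_simps)
qed

lemma dirichlet_laplacian_eigenfunction:
  assumes "a < b" and D: "dirichlet_laplacian a b u (\<lambda>x. of_real l * u x)"
  obtains (zero) "\<And>x. x \<in> {a..b} \<Longrightarrow> u x = 0"
  | (sine) c where "l > 0" "sin (sqrt l * (b - a)) = 0"
      "\<And>x. x \<in> {a..b} \<Longrightarrow> u x = c * of_real (sin (sqrt l * (x - a)))"
proof -
  from D obtain u' where ab: "u a = 0" "u b = 0" and 1: "H1_deriv a b u u'"
    and 2: "H1_deriv a b u' (\<lambda>x. - (of_real l * u x))"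
    unfolding dirichlet_laplacian_def by blast
  have u: "(u has_vector_derivative u' x) (at x within {a..b})" if "x \<in> {a..b}" for x
    by (rule H1_deriv_has_vector_derivative[OF 1 H1_deriv_continuous_on[OF 2] that])
  have u': "(u' has_vector_derivative - (of_real l * u x)) (at x within {a..b})" if "x \<in> {a..b}" for x
    by (rule H1_deriv_has_vector_derivative[OF 2 _ that])
       (intro continuous_intros H1_deriv_continuous_on[OF 1])
  show thesis
  proof (cases "l > 0")
    case False
    then show thesis using dirichlet_nonpositive_eigenvalue[of u a b l u'] ab u u' zero by force
  next
    case True
    let ?c = "u' a / of_real (sqrt l)"
    have *: "u x = ?c * of_real (sin (sqrt l * (x - a)))" if "x \<in> {a..b}" for x
      by (rule dirichlet_positive_eigenvalue[of u a "sqrt l" b u'])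
         (use True ab u u' that in \<open>auto simp: scaleR_conv_of_real\<close>)
    show thesis
    proof (cases "?c = 0")
      case True
      with * show thesis by (intro zero) simp
    next
      case c: False
      have "?c * of_real (sin (sqrt l * (b - a))) = 0" using *[of b] ab \<open>a < b\<close> by simp
      with c have "sin (sqrt l * (b - a)) = 0" by simp
      with True * show thesis by (intro sine[of ?c]) blast+
    qed
  qed
qed

section \<open>Edges and their sine modes\<close>

lemma vertex_0 [simp]: "vertex 0 = 0"
  by (simp add: vertex_def)

lemma vertex_Suc: "vertex (Suc n) = vertex n + pi / real (Suc n)"
  by (simp add: vertex_def)

lemma vertex_pred: "j \<ge> 1 \<Longrightarrow> vertex j = vertex (j - 1) + pi / real j"
  using vertex_Suc[of "j - 1"] by simp

lemma vertex_less_iff [simp]: "vertex m < vertex n \<longleftrightarrow> m < n"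
proof -
  have "strict_mono vertex" by (rule strict_monoI_Suc) (simp add: vertex_Suc)
  then show ?thesis by (simp add: strict_mono_less)
qed

lemma vertex_le_iff [simp]: "vertex m \<le> vertex n \<longleftrightarrow> m \<le> n"
  using vertex_less_iff[of n m] by linarith

lemma vertex_nonneg: "vertex n \<ge> 0"
  using vertex_le_iff[of 0 n] by simp

text \<open>The edge lengths form a multiple of the harmonic series.\<close>

lemma vertex_unbounded: "\<exists>n. x < vertex n"
proof -
  have v: "vertex n = pi * harm n" for n
    by (simp add: vertex_def harm_def sum_distrib_left divide_inverse)
  have "eventually (\<lambda>n. x / pi < harm n) sequentially"
    using harm_at_top unfolding filterlim_at_top_dense by blast
  then obtain n where "x / pi < harm n"
    unfolding eventually_sequentially by blast
  then have "x < vertex n" by (simp add: v pos_divide_less_eq mult.commute)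
  then show ?thesis ..
qed

lemma edge_containing:
  assumes "x \<ge> 0"
  obtains j where "j \<ge> 1" "vertex (j - 1) \<le> x" "x < vertex j"
proof
  define j where "j = (LEAST n. x < vertex n)"
  show j: "x < vertex j" unfolding j_def by (rule LeastI_ex) (rule vertex_unbounded)
  then show "j \<ge> 1" using assms by (cases j) auto
  then show "vertex (j - 1) \<le> x"
    using not_less_Least[of "j - 1" "\<lambda>n. x < vertex n"] by (simp add: j_def[symmetric])
qed

text \<open>When \<open>j\<close> divides \<open>m\<close>, this is the unnormalised eigenfunction for the eigenvalue \<open>m\<^sup>2\<close> that lives on
the edge of length \<open>pi / j\<close>; otherwise the sine does not vanish at the right end of the edge.\<close>

definition edge_mode :: "nat \<Rightarrow> nat \<Rightarrow> real \<Rightarrow> complex" where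
  "edge_mode j m x = (if x \<in> {vertex (j - 1)..vertex j}
     then of_real (sin (real m * (x - vertex (j - 1)))) else 0)"

lemma sin_multiple_edge_length:
  assumes "j \<ge> 1" "j dvd m"
  shows "sin (real m * (pi / real j)) = 0"
proof -
  from assms(2) obtain k where "m = j * k" ..
  with assms(1) have "real m * (pi / real j) = real k * pi" by simp
  then show ?thesis by simp
qed

lemma edge_mode_vertex:
  assumes "j \<ge> 1" "j dvd m"
  shows "edge_mode j m (vertex i) = 0"
proof (cases "i = j - 1 \<or> i = j")
  case True
  then show ?thesis
    using sin_multiple_edge_length[OF assms] vertex_pred[OF assms(1)] by (auto simp: edge_mode_def)
next
  case False
  with assms(1) have "\<not> (j - 1 \<le> i \<and> i \<le> j)" by linarith
  then show ?thesis by (auto simp: edge_mode_def)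
qed

text \<open>Neighbouring closed edges share a vertex, but the modes vanish there; hence the half-open edges, which
partition the half-line, separate the modes.\<close>

lemma edge_mode_off_edge:
  assumes x: "vertex (i - 1) \<le> x" "x < vertex i" and j: "j \<ge> 1" "j dvd m" "j \<noteq> i"
  shows "edge_mode j m x = 0"
proof (cases "j < i")
  case True
  then have "vertex j \<le> vertex (i - 1)" by simp
  show ?thesis
  proof (cases "x = vertex j")
    case True
    then show ?thesis using edge_mode_vertex j by simp
  next
    case False
    with x \<open>vertex j \<le> vertex (i - 1)\<close> have "vertex j < x" by linarith
    then show ?thesis by (simp add: edge_mode_def)
  qed
next
  case False
  with j have "vertex i \<le> vertex (j - 1)" by simp
  with x have "x < vertex (j - 1)" by linarith
  then show ?thesis by (simp add: edge_mode_def)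
qed

lemma edge_mode_disjoint:
  assumes "x \<ge> 0" "i \<ge> 1" "j \<ge> 1" "i \<noteq> j" "i dvd m" "j dvd m'"
  shows "edge_mode i m x = 0 \<or> edge_mode j m' x = 0"
proof -
  obtain k where "vertex (k - 1) \<le> x" "x < vertex k" using edge_containing \<open>x \<ge> 0\<close> by blast
  with edge_mode_off_edge assms show ?thesis by (cases "i = k") auto
qed

lemma integrable_edge_supported:
  fixes h :: "real \<Rightarrow> 'a::euclidean_space"
  assumes "0 \<le> a" "continuous_on {a..b} h"
  shows "integrable (lebesgue_on {0..}) (\<lambda>x. if x \<in> {a..b} then h x else 0)"
    and "(LINT x|lebesgue_on {0..}. (if x \<in> {a..b} then h x else 0)) = integral {a..b} h"
proof -
  have h: "integrable (lebesgue_on {a..b}) h"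
    using assms(2) by (rule continuous_imp_integrable_real)
  have "(if x \<in> {0..} then if x \<in> {a..b} then h x else 0 else 0) = (if x \<in> {a..b} then h x else 0)" for x
    using assms(1) by auto
  then show "integrable (lebesgue_on {0..}) (\<lambda>x. if x \<in> {a..b} then h x else 0)"
    by (subst Lebesgue_Measure.integrable_restrict_UNIV[symmetric])
       (simp_all add: Lebesgue_Measure.integrable_restrict_UNIV h del: atLeastAtMost_iff atLeast_iff)
  have "{a..b} \<subseteq> {0..}" using assms(1) by auto
  then show "(LINT x|lebesgue_on {0..}. (if x \<in> {a..b} then h x else 0)) = integral {a..b} h"
    using lebesgue_integral_eq_integral[OF h]
    by (subst Lebesgue_Measure.integral_restrict) simp_all
qed

lemma edge_mode_L2_on: "edge_mode j m \<in> L2_on {0..}"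
proof -
  have "edge_mode j m \<in> borel_measurable borel"
    unfolding edge_mode_def by measurable
  then have "edge_mode j m \<in> borel_measurable lebesgue"
    using measurable_completion measurable_lborel2 by blast
  then have "edge_mode j m \<in> borel_measurable (lebesgue_on {0..})"
    by (rule measurable_restrict_space1)
  moreover have "(cmod (edge_mode j m x))\<^sup>2 = (if x \<in> {vertex (j - 1)..vertex j}
       then (sin (real m * (x - vertex (j - 1))))\<^sup>2 else 0)" for x
    by (simp add: edge_mode_def)
  ultimately show ?thesis
    unfolding L2_on_def
    by (auto simp del: atLeastAtMost_iff intro!: integrable_edge_supported vertex_nonneg continuous_intros)
qed

text \<open>The product-to-sum formulas give primitives, and all boundary terms vanish because \<open>p * L\<close> and
\<open>q * L\<close> are multiples of \<open>pi\<close>.\<close>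

lemma integral_sin_sin:
  fixes p q a L :: real
  assumes "p > 0" "q > 0" "L \<ge> 0" "sin (p * L) = 0" "sin (q * L) = 0"
  shows "integral {a..a + L} (\<lambda>x. sin (p * (x - a)) * sin (q * (x - a))) = (if p = q then L / 2 else 0)"
proof (cases "p = q")
  case True
  define G where "G = (\<lambda>x. (x - a) / 2 - sin (2 * p * (x - a)) / (4 * p))"
  have "((\<lambda>x. sin (p * (x - a)) * sin (q * (x - a))) has_integral (G (a + L) - G a)) {a..a + L}"
  proof (rule fundamental_theorem_of_calculus)
    fix x
    have "(G has_real_derivative 1 / 2 - cos (2 * (p * (x - a))) / 2) (at x within {a..a + L})"
      unfolding G_def using assms(1)
      by (auto intro!: derivative_eq_intros simp: field_simps)
    also have "1 / 2 - cos (2 * (p * (x - a))) / 2 = sin (p * (x - a)) * sin (q * (x - a))"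
      unfolding cos_double_sin by (simp add: True power2_eq_square field_simps)
    finally show "(G has_vector_derivative sin (p * (x - a)) * sin (q * (x - a))) (at x within {a..a + L})"
      by (simp add: has_real_derivative_iff_has_vector_derivative)
  qed (use assms in simp)
  moreover have "sin (2 * p * L) = 0" using sin_double[of "p * L"] assms(4) by (simp add: mult.assoc)
  ultimately show ?thesis using True by (simp add: integral_unique G_def)
next
  case False
  \<comment> \<open>the same primitive serves the difference and the sum of the frequencies\<close>
  have primitive: "((\<lambda>x. sin (r * (x - a)) / (2 * r)) has_real_derivative cos (r * (x - a)) / 2) (at x within X)"
    if "r \<noteq> 0" for r x X
    using that by (auto intro!: derivative_eq_intros)
  define G where "G = (\<lambda>x. sin ((p - q) * (x - a)) / (2 * (p - q)) - sin ((p + q) * (x - a)) / (2 * (p + q)))"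
  have "((\<lambda>x. sin (p * (x - a)) * sin (q * (x - a))) has_integral (G (a + L) - G a)) {a..a + L}"
  proof (rule fundamental_theorem_of_calculus)
    fix x
    have "(G has_real_derivative cos ((p - q) * (x - a)) / 2 - cos ((p + q) * (x - a)) / 2)
      (at x within {a..a + L})"
      unfolding G_def by (intro DERIV_diff primitive) (use assms False in auto)
    also have "cos ((p - q) * (x - a)) / 2 - cos ((p + q) * (x - a)) / 2 = sin (p * (x - a)) * sin (q * (x - a))"
      by (simp add: left_diff_distrib distrib_right cos_diff cos_add) (simp add: field_simps)
    finally show "(G has_vector_derivative sin (p * (x - a)) * sin (q * (x - a))) (at x within {a..a + L})"
      by (simp add: has_real_derivative_iff_has_vector_derivative)
  qed (use assms in simp)
  moreover have "sin ((p - q) * L) = 0" "sin ((p + q) * L) = 0"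
    using assms by (simp_all add: left_diff_distrib distrib_right sin_diff sin_add)
  ultimately show ?thesis using False by (simp add: integral_unique G_def)
qed

lemma edge_mode_inner:
  assumes "i \<ge> 1" "j \<ge> 1" "i dvd m" "j dvd n" "m \<ge> 1" "n \<ge> 1"
  shows "L2_inner {0..} (edge_mode i m) (edge_mode j n)
    = (if i = j \<and> m = n then of_real (pi / (2 * real j)) else 0)"
proof (cases "i = j")
  case False
  have "L2_inner {0..} (edge_mode i m) (edge_mode j n) = (LINT x|lebesgue_on {0::real..}. 0)"
    unfolding L2_inner_def
  proof (rule Bochner_Integration.integral_cong[OF refl])
    fix x assume "x \<in> space (lebesgue_on {0::real..})"
    then have "x \<ge> 0" by simp
    from edge_mode_disjoint[OF this assms(1,2) False assms(3,4)]
    show "cnj (edge_mode i m x) * edge_mode j n x = 0" by auto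
  qed
  then show ?thesis using False by simp
next
  case True
  let ?a = "vertex (j - 1)" and ?L = "pi / real j"
  let ?h = "\<lambda>x. sin (real m * (x - ?a)) * sin (real n * (x - ?a))"
  have "cnj (edge_mode i m x) * edge_mode j n x
      = of_real (if x \<in> {?a..?a + ?L} then ?h x else 0)" for x
    using True vertex_pred[OF assms(2)] by (simp add: edge_mode_def)
  then have "L2_inner {0..} (edge_mode i m) (edge_mode j n)
      = of_real (LINT x|lebesgue_on {0..}. (if x \<in> {?a..?a + ?L} then ?h x else 0))"
    unfolding L2_inner_def by (simp only: integral_complex_of_real)
  also have "(LINT x|lebesgue_on {0..}. (if x \<in> {?a..?a + ?L} then ?h x else 0)) = integral {?a..?a + ?L} ?h"
    by (rule integrable_edge_supported) (intro vertex_nonneg continuous_intros)+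
  also have "\<dots> = (if real m = real n then ?L / 2 else 0)"
    by (rule integral_sin_sin) (use assms True sin_multiple_edge_length in auto)
  finally show ?thesis using True by (simp add: mult.commute)
qed

section \<open>Eigenbases and edge modes\<close>

lemma finite_divisors: "(m::nat) \<ge> 1 \<Longrightarrow> finite {j. j dvd m}"
  by simp

text \<open>A combination of modes reduces on each edge to the single mode of that edge.\<close>

lemma edge_mode_combination:
  assumes "m \<ge> 1" "vertex (i - 1) \<le> x" "x < vertex i"
  shows "(\<Sum>j | j dvd m. c j * edge_mode j m x) = (if i dvd m then c i * edge_mode i m x else 0)"
proof -
  have "(\<Sum>j | j dvd m. c j * edge_mode j m x)
      = (\<Sum>j | j dvd m. if j = i then c i * edge_mode i m x else 0)"
  proof (rule sum.cong[OF refl])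
    fix j assume "j \<in> {j. j dvd m}"
    moreover from this have "j \<ge> 1" using assms(1) by (cases j) auto
    ultimately show "c j * edge_mode j m x = (if j = i then c i * edge_mode i m x else 0)"
      using edge_mode_off_edge[OF assms(2,3), of j m] by auto
  qed
  then show ?thesis using finite_divisors[OF assms(1)] by simp
qed

lemma dvd_if_sin_edge_eq_0:
  assumes "j \<ge> 1" "sin (real m * (pi / real j)) = 0"
  shows "j dvd m"
proof -
  obtain k :: int where "real m * (pi / real j) = of_int k * pi"
    using assms(2) unfolding sin_zero_iff_int2 by blast
  then have "real m = of_int k * real j" using assms(1) by (simp add: field_simps)
  then have "int m = k * int j"
    by (metis of_int_eq_iff of_int_mult of_int_of_nat_eq)
  then have "int j dvd int m" by simp
  then show ?thesis by simp
qed

text \<open>An eigenfunction that is nonzero on the \<open>i\<close>-th edge forces \<open>sqrt l * pi / i\<close> to be a multiple of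
\<open>pi\<close>, so \<open>sqrt l\<close> is a positive integer \<open>m\<close>. By the same reasoning on every other edge, the
eigenfunction can live only on edges whose index divides \<open>m\<close>, of which there are finitely many.\<close>

lemma H_infinity_eigenfunction:
  assumes H: "H_infinity u (\<lambda>x. of_real l * u x)" and nz: "\<exists>x\<ge>0. u x \<noteq> 0"
  shows "\<exists>m c. m \<ge> 1 \<and> l = (real m)\<^sup>2 \<and>
    (\<forall>x\<ge>0. u x = (\<Sum>j | j dvd m. c j * edge_mode j m x))"
proof -
  have D: "dirichlet_laplacian (vertex (j - 1)) (vertex j) u (\<lambda>x. of_real l * u x)" if "j \<ge> 1" for j
    using H that by (simp add: H_infinity_def)
  have len: "vertex (j - 1) < vertex j" "vertex j - vertex (j - 1) = pi / real j" if "j \<ge> 1" for j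
    using vertex_pred[OF that] that by simp_all
  have sine: "(\<forall>x\<in>{vertex (j - 1)..vertex j}. u x = 0) \<or>
     (l > 0 \<and> sin (sqrt l * (pi / real j)) = 0 \<and>
       (\<exists>c. \<forall>x\<in>{vertex (j - 1)..vertex j}. u x = c * of_real (sin (sqrt l * (x - vertex (j - 1))))))"
    if "j \<ge> 1" for j
  proof (rule dirichlet_laplacian_eigenfunction[OF len(1)[OF that] D[OF that]])
    fix c assume "l > 0" "sin (sqrt l * (vertex j - vertex (j - 1))) = 0"
      "\<And>x. x \<in> {vertex (j - 1)..vertex j} \<Longrightarrow> u x = c * of_real (sin (sqrt l * (x - vertex (j - 1))))"
    then show ?thesis unfolding len(2)[OF that] by blast
  qed blast
  obtain y where y: "y \<ge> 0" "u y \<noteq> 0" using nz by blast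
  obtain i where i: "i \<ge> 1" "vertex (i - 1) \<le> y" "y < vertex i" using edge_containing[OF y(1)] .
  have l: "l > 0" and s0: "sin (sqrt l * (pi / real i)) = 0"
    using sine[OF i(1)] y i by (meson atLeastAtMost_iff less_imp_le)+
  from s0 obtain k :: int where "sqrt l * (pi / real i) = of_int k * pi"
    unfolding sin_zero_iff_int2 by blast
  then have k: "sqrt l = of_int k * real i" using i(1) by (simp add: field_simps)
  have "0 < of_int k * real i" using k l real_sqrt_gt_zero[of l] by simp
  then have "k > 0" using i(1) by (simp add: zero_less_mult_iff)
  define m where "m = nat k * i"
  have m: "sqrt l = real m" using k \<open>k > 0\<close> by (simp add: m_def)
  have "m \<ge> 1" using \<open>k > 0\<close> i(1) by (simp add: m_def Suc_le_eq)
  have "\<exists>c. (\<forall>x\<in>{vertex (j - 1)..vertex j}. u x = c * edge_mode j m x) \<and> (\<not> j dvd m \<longrightarrow> c = 0)"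
    if "j \<ge> 1" for j
    using sine[OF that]
  proof (elim disjE conjE exE)
    assume "\<forall>x\<in>{vertex (j - 1)..vertex j}. u x = 0"
    then show ?thesis by (intro exI[of _ 0]) simp
  next
    fix c assume "sin (sqrt l * (pi / real j)) = 0"
      and c: "\<forall>x\<in>{vertex (j - 1)..vertex j}. u x = c * of_real (sin (sqrt l * (x - vertex (j - 1))))"
    then have "j dvd m" using dvd_if_sin_edge_eq_0[OF that] m by simp
    with c show ?thesis by (intro exI[of _ c]) (simp add: edge_mode_def m)
  qed
  then obtain c where c: "\<And>j x. j \<ge> 1 \<Longrightarrow> x \<in> {vertex (j - 1)..vertex j} \<Longrightarrow> u x = c j * edge_mode j m x"
      "\<And>j. j \<ge> 1 \<Longrightarrow> \<not> j dvd m \<Longrightarrow> c j = 0"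
    by metis
  have "u x = (\<Sum>j | j dvd m. c j * edge_mode j m x)" if "x \<ge> 0" for x
  proof -
    obtain j where j: "j \<ge> 1" "vertex (j - 1) \<le> x" "x < vertex j" using edge_containing[OF \<open>x \<ge> 0\<close>] .
    then have "u x = c j * edge_mode j m x" by (intro c) auto
    then show ?thesis
      using edge_mode_combination[OF \<open>m \<ge> 1\<close> j(2,3)] c(2)[OF j(1)] by auto
  qed
  moreover have "l = (real m)\<^sup>2" using real_sqrt_pow2[of l] l m by simp
  ultimately show ?thesis using \<open>m \<ge> 1\<close> by blast
qed

text \<open>The data of an ordered eigenbasis that matter below: \<open>freq n\<close> is the square root of the \<open>n\<close>-th
eigenvalue, and row \<open>n\<close> of the matrix \<open>coef\<close> expresses the \<open>n\<close>-th eigenfunction in edge modes.\<close>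

locale edge_mode_basis =
  fixes f :: "nat \<Rightarrow> real \<Rightarrow> complex" and freq :: "nat \<Rightarrow> nat" and coef :: "nat \<Rightarrow> nat \<Rightarrow> complex"
  assumes basis: "orthonormal_basis_L2 {0..} f"
    and freq_pos: "n \<ge> 1 \<Longrightarrow> freq n \<ge> 1"
    and freq_mono: "1 \<le> m \<Longrightarrow> m \<le> n \<Longrightarrow> freq m \<le> freq n"
    and expansion: "n \<ge> 1 \<Longrightarrow> x \<ge> 0 \<Longrightarrow> f n x = (\<Sum>j | j dvd freq n. coef n j * edge_mode j (freq n) x)"
begin

lemma inner_edge_mode:
  assumes "n \<ge> 1" "m \<ge> 1" "j dvd m"
  shows "L2_inner {0..} (f n) (edge_mode j m)
    = (if freq n = m then cnj (coef n j) * of_real (pi / (2 * real j)) else 0)"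
proof -
  have pos: "i \<ge> 1" if "i dvd k" "k \<ge> 1" for i k :: nat using that by (cases i) auto
  have "L2_inner {0..} (f n) (edge_mode j m)
      = L2_inner {0..} (\<lambda>x. \<Sum>i | i dvd freq n. coef n i * edge_mode i (freq n) x) (edge_mode j m)"
    by (rule L2_inner_cong) (use expansion assms in auto)
  also have "\<dots> = (\<Sum>i | i dvd freq n. cnj (coef n i) * L2_inner {0..} (edge_mode i (freq n)) (edge_mode j m))"
    by (rule L2_inner_sum_left) (use finite_divisors[OF freq_pos[OF assms(1)]] edge_mode_L2_on in auto)
  also have "\<dots> = (\<Sum>i | i dvd freq n. if i = j then
      (if freq n = m then cnj (coef n j) * of_real (pi / (2 * real j)) else 0) else 0)"
    by (rule sum.cong[OF refl], subst edge_mode_inner) (use assms freq_pos pos in auto)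
  also have "\<dots> = (if freq n = m then cnj (coef n j) * of_real (pi / (2 * real j)) else 0)"
    using finite_divisors[OF freq_pos[OF assms(1)]] assms(3) by auto
  finally show ?thesis .
qed

text \<open>The rows of the matrix \<open>coef\<close>, weighted by the squared norms \<open>pi / (2 j)\<close> of the modes, are unit
vectors because the eigenfunctions are.\<close>

lemma coef_normalised:
  assumes "n \<ge> 1"
  shows "(\<Sum>j | j dvd freq n. (cmod (coef n j))\<^sup>2 * (pi / (2 * real j))) = 1"
proof -
  have fn: "f n \<in> L2_on {0..}" "L2_inner {0..} (f n) (f n) = 1"
    using basis assms by (auto simp: orthonormal_basis_L2_def)
  have "1 = L2_inner {0..} (f n) (f n)" using fn by simp
  also have "\<dots> = L2_inner {0..} (f n) (\<lambda>x. \<Sum>j | j dvd freq n. coef n j * edge_mode j (freq n) x)"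
    by (rule L2_inner_cong) (use expansion assms in auto)
  also have "\<dots> = (\<Sum>j | j dvd freq n. coef n j * L2_inner {0..} (f n) (edge_mode j (freq n)))"
    by (rule L2_inner_sum_right) (use finite_divisors[OF freq_pos[OF assms]] edge_mode_L2_on fn in auto)
  also have "\<dots> = (\<Sum>j | j dvd freq n. of_real ((cmod (coef n j))\<^sup>2 * (pi / (2 * real j))))"
  proof (rule sum.cong[OF refl])
    fix j assume "j \<in> {j. j dvd freq n}"
    then show "coef n j * L2_inner {0..} (f n) (edge_mode j (freq n))
        = of_real ((cmod (coef n j))\<^sup>2 * (pi / (2 * real j)))"
      using inner_edge_mode[OF assms freq_pos[OF assms], of j]
      by (simp only: mem_Collect_eq if_True refl of_real_mult complex_norm_square mult.assoc)
  qed
  finally have "complex_of_real 1 = of_real (\<Sum>j | j dvd freq n. (cmod (coef n j))\<^sup>2 * (pi / (2 * real j)))"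
    by (simp only: of_real_sum of_real_1)
  then show ?thesis by (simp only: of_real_eq_iff)
qed

definition level :: "nat \<Rightarrow> nat set" where
  "level m = {n. n \<ge> 1 \<and> freq n = m}"

text \<open>The columns of the weighted matrix are unit vectors as well: this is Parseval's identity for an edge
mode, which is orthogonal to all eigenfunctions of a different frequency.\<close>

lemma coef_has_sum:
  assumes "m \<ge> 1" "j dvd m"
  shows "((\<lambda>n. if freq n = m then (cmod (coef n j))\<^sup>2 * (pi / (2 * real j)) else 0) has_sum 1) {1..}"
proof -
  let ?w = "pi / (2 * real j)"
  have "j \<ge> 1" using assms by (cases j) auto
  then have w: "?w > 0" by simp
  have "((\<lambda>n. (cmod (L2_inner {0..} (f n) (edge_mode j m)))\<^sup>2) has_sum
      Re (L2_inner {0..} (edge_mode j m) (edge_mode j m))) {1..}"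
    by (rule parseval[OF basis edge_mode_L2_on])
  also have "L2_inner {0..} (edge_mode j m) (edge_mode j m) = of_real ?w"
    by (subst edge_mode_inner) (use \<open>j \<ge> 1\<close> assms in auto)
  finally have "((\<lambda>n. 1 / ?w * (cmod (L2_inner {0..} (f n) (edge_mode j m)))\<^sup>2) has_sum
      (1 / ?w * Re (of_real ?w))) {1..}"
    by (rule has_sum_cmult_right)
  also have "1 / ?w * Re (of_real ?w) = 1" using \<open>j \<ge> 1\<close> by simp
  finally show ?thesis
  proof (rule has_sum_cong[THEN iffD1, rotated])
    fix n :: nat assume "n \<in> {1..}"
    then have "cmod (L2_inner {0..} (f n) (edge_mode j m)) = (if freq n = m then cmod (coef n j) * ?w else 0)"
      using inner_edge_mode[of n m j] assms by (simp add: norm_mult norm_divide)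
    then show "1 / ?w * (cmod (L2_inner {0..} (f n) (edge_mode j m)))\<^sup>2
      = (if freq n = m then (cmod (coef n j))\<^sup>2 * ?w else 0)"
      using \<open>j \<ge> 1\<close> by (simp add: power2_eq_square)
  qed
qed

lemma level_coef_normalised:
  assumes "n \<in> level m"
  shows "(\<Sum>j | j dvd m. (cmod (coef n j))\<^sup>2 * (pi / (2 * real j))) = 1"
  using coef_normalised[of n] assms unfolding level_def by blast

text \<open>Double counting of the weighted squares of the entries: each of the rows in \<open>F\<close> contributes 1, and
each column contributes at most 1. This bounds the multiplicity of an eigenvalue before the finiteness of its
level is known; \<open>card_level\<close> repeats the count for the whole level, where the columns contribute
exactly 1.\<close>

lemma card_finite_subset_level:
  assumes "m \<ge> 1" "F \<subseteq> level m" "finite F"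
  shows "card F \<le> card {j. j dvd m}"
proof -
  have "real (card F) = (\<Sum>n\<in>F. 1)" by simp
  also have "\<dots> = (\<Sum>n\<in>F. \<Sum>j | j dvd m. (cmod (coef n j))\<^sup>2 * (pi / (2 * real j)))"
    by (rule sum.cong[OF refl], rule level_coef_normalised[symmetric]) (use assms(2) in blast)
  also have "\<dots> = (\<Sum>j | j dvd m. \<Sum>n\<in>F. (cmod (coef n j))\<^sup>2 * (pi / (2 * real j)))"
    by (rule sum.swap)
  also have "\<dots> \<le> (\<Sum>j | j dvd m. 1)"
  proof (rule sum_mono)
    fix j assume "j \<in> {j. j dvd m}"
    then have "j dvd m" by simp
    have "(\<Sum>n\<in>F. (cmod (coef n j))\<^sup>2 * (pi / (2 * real j)))
       = (\<Sum>n\<in>F. if freq n = m then (cmod (coef n j))\<^sup>2 * (pi / (2 * real j)) else 0)"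
      by (rule sum.cong) (use assms in \<open>auto simp: level_def\<close>)
    also have "\<dots> \<le> 1"
      by (rule finite_sum_le_has_sum[OF coef_has_sum[OF assms(1) \<open>j dvd m\<close>]])
         (use assms in \<open>auto simp: level_def\<close>)
    finally show "(\<Sum>n\<in>F. (cmod (coef n j))\<^sup>2 * (pi / (2 * real j))) \<le> 1" .
  qed
  finally show ?thesis by simp
qed

lemma finite_level:
  assumes "m \<ge> 1"
  shows "finite (level m)"
  by (rule conjunct1[OF finite_if_finite_subsets_card_bdd[of "level m"]])
     (rule card_finite_subset_level[OF assms])

lemma level_coef_sum:
  assumes "m \<ge> 1" "j dvd m"
  shows "(\<Sum>n\<in>level m. (cmod (coef n j))\<^sup>2 * (pi / (2 * real j))) = 1"
proof (rule has_sum_unique[OF _ coef_has_sum[OF assms]])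
  show "((\<lambda>n. if freq n = m then (cmod (coef n j))\<^sup>2 * (pi / (2 * real j)) else 0) has_sum
    (\<Sum>n\<in>level m. (cmod (coef n j))\<^sup>2 * (pi / (2 * real j)))) {1..}"
    by (rule has_sum_finite_neutralI[OF finite_level[OF assms(1)]]) (auto simp: level_def)
qed

lemma card_level:
  assumes "m \<ge> 1"
  shows "card (level m) = card {j. j dvd m}"
proof -
  have "real (card (level m)) = (\<Sum>n\<in>level m. 1)" by simp
  also have "\<dots> = (\<Sum>n\<in>level m. \<Sum>j | j dvd m. (cmod (coef n j))\<^sup>2 * (pi / (2 * real j)))"
    by (rule sum.cong[OF refl], rule level_coef_normalised[symmetric])
  also have "\<dots> = (\<Sum>j | j dvd m. \<Sum>n\<in>level m. (cmod (coef n j))\<^sup>2 * (pi / (2 * real j)))"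
    by (rule sum.swap)
  also have "\<dots> = (\<Sum>j | j dvd m. 1)"
    by (rule sum.cong) (use level_coef_sum assms in auto)
  finally show ?thesis by simp
qed

text \<open>The sum of \<open>\<bar>f n x\<bar>\<^sup>2\<close> over an orthonormal basis of an eigenspace is the same for every basis of that
eigenspace, so it equals its value for the normalised edge modes, of which at most one is nonzero at
\<open>x\<close>. Concretely, only the squares in one column of \<open>coef\<close> enter, and their sum is known.\<close>

lemma level_square_sum:
  assumes "m \<ge> 1" "j \<ge> 1" "vertex (j - 1) \<le> x" "x < vertex j"
  shows "(\<Sum>n\<in>level m. (cmod (f n x))\<^sup>2)
    = (if j dvd m then 2 * real j / pi * (sin (real m * (x - vertex (j - 1))))\<^sup>2 else 0)"
proof -
  let ?s = "sin (real m * (x - vertex (j - 1)))" and ?w = "pi / (2 * real j)"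
  have "x \<ge> 0" using assms(3) vertex_nonneg[of "j - 1"] by linarith
  have f: "f n x = (if j dvd m then coef n j * of_real ?s else 0)" if "n \<in> level m" for n
    using that expansion[OF _ \<open>x \<ge> 0\<close>, of n] edge_mode_combination[OF assms(1,3,4), of "coef n"] assms
    by (auto simp: level_def edge_mode_def)
  show ?thesis
  proof (cases "j dvd m")
    case True
    have "(\<Sum>n\<in>level m. (cmod (f n x))\<^sup>2) = (\<Sum>n\<in>level m. (1 / ?w * ?s\<^sup>2) * ((cmod (coef n j))\<^sup>2 * ?w))"
      by (rule sum.cong) (use f True assms(2) in \<open>auto simp: norm_mult power_mult_distrib\<close>)
    also have "\<dots> = 1 / ?w * ?s\<^sup>2"
      by (subst sum_distrib_left[symmetric], subst level_coef_sum) (use assms True in auto)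
    finally show ?thesis using True by simp
  qed (use f in simp)
qed

end

section \<open>Divisor sums and the inversion of \<open>s ln s\<close>\<close>

lemma sum_over_multiples:
  fixes g :: "nat \<Rightarrow> 'a::comm_monoid_add"
  assumes "j \<ge> 1"
  shows "(\<Sum>m=1..M. if j dvd m then g m else 0) = (\<Sum>k=1..M div j. g (j * k))"
proof -
  have "(\<Sum>k=1..M div j. g (j * k)) = (\<Sum>m | m \<in> {1..M} \<and> j dvd m. g m)"
  proof (rule sum.reindex_bij_witness[where i = "\<lambda>m. m div j" and j = "\<lambda>k. j * k"])
    fix k assume "k \<in> {1..M div j}"
    then have k: "1 \<le> k" "k \<le> M div j" by auto
    have "j * k \<le> j * (M div j)" using k(2) by (rule mult_le_mono2)
    also have "\<dots> \<le> M" by simp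
    finally show "j * k \<in> {m \<in> {1..M}. j dvd m}" using k(1) assms by simp
    show "j * k div j = k" using assms by simp
  next
    fix m assume m: "m \<in> {m \<in> {1..M}. j dvd m}"
    then show "j * (m div j) = m" by simp
    have "m div j \<noteq> 0" using m assms by (auto simp: div_eq_0_iff dest: dvd_imp_le)
    then show "m div j \<in> {1..M div j}" using m by (simp add: div_le_mono)
  qed simp
  also have "\<dots> = (\<Sum>m=1..M. if j dvd m then g m else 0)"
    by (rule sum.inter_filter) simp
  finally show ?thesis by simp
qed

text \<open>The summatory function of Dirichlet's divisor problem. It counts the eigenvalues up to \<open>M\<^sup>2\<close> with
multiplicity.\<close>

definition divisor_summatory :: "nat \<Rightarrow> nat" where
  "divisor_summatory M = (\<Sum>m=1..M. card {j. j dvd m})"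

lemma divisor_summatory_mono: "M \<le> M' \<Longrightarrow> divisor_summatory M \<le> divisor_summatory M'"
  unfolding divisor_summatory_def by (rule sum_mono2) auto

text \<open>Both sides count the pairs \<open>(j, m)\<close> with \<open>j dvd m\<close> and \<open>m \<le> M\<close>.\<close>

lemma divisor_summatory_eq: "divisor_summatory M = (\<Sum>j=1..M. M div j)"
proof -
  have "card {j. j dvd m} = (\<Sum>j=1..M. if j dvd m then 1 else 0)" if "m \<in> {1..M}" for m
  proof -
    have "{j. j dvd m} = {j \<in> {1..M}. j dvd m}"
      using that by (auto dest: dvd_imp_le intro: Suc_leI dvd_pos_nat)
    then show ?thesis by (simp flip: sum.inter_filter)
  qed
  then have "divisor_summatory M = (\<Sum>m=1..M. \<Sum>j=1..M. if j dvd m then 1 else 0)"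
    by (simp add: divisor_summatory_def)
  also have "\<dots> = (\<Sum>j=1..M. \<Sum>m=1..M. if j dvd m then 1 else 0)"
    by (rule sum.swap)
  also have "\<dots> = (\<Sum>j=1..M. M div j)"
    by (rule sum.cong[OF refl], subst sum_over_multiples) auto
  finally show ?thesis .
qed

lemma harm_le_1_plus_ln: "n \<ge> 1 \<Longrightarrow> harm n \<le> 1 + ln (real n)"
  using decseqD[OF decseq_harm_diff_ln, of 0 "n - 1"] by (simp add: harm_expand)

lemma divisor_summatory_upper:
  assumes "M \<ge> 1"
  shows "real (divisor_summatory M) \<le> real M * ln (real M) + real M"
proof -
  have "real (divisor_summatory M) = (\<Sum>j=1..M. real (M div j))"
    by (simp add: divisor_summatory_eq)
  also have "\<dots> \<le> (\<Sum>j=1..M. real M / real j)"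
    by (intro sum_mono of_nat_div_le_of_nat)
  also have "\<dots> = real M * harm M"
    by (simp add: harm_def sum_distrib_left divide_inverse)
  also have "\<dots> \<le> real M * (1 + ln (real M))"
    using harm_le_1_plus_ln[OF assms] by (intro mult_left_mono) auto
  finally show ?thesis by (simp add: distrib_left)
qed

lemma divisor_summatory_lower:
  "real (divisor_summatory M) \<ge> real M * ln (real M + 1) - real M"
proof -
  have "real M * ln (real M + 1) - real M \<le> real M * harm M - real M"
    using ln_le_harm[of M] by (simp add: mult_left_mono)
  also have "\<dots> = (\<Sum>j=1..M. real M / real j - 1)"
    by (simp add: harm_def sum_distrib_left divide_inverse sum_subtractf)
  also have "\<dots> \<le> (\<Sum>j=1..M. real (M div j))"
  proof (rule sum_mono)
    fix j assume "j \<in> {1..M}"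
    then have "real (M mod j) / real j \<le> 1" by (simp add: less_imp_le)
    then show "real M / real j - 1 \<le> real (M div j)"
      using of_nat_of_nat_div_aux[of M j, where 'a = real] by linarith
  qed
  also have "\<dots> = real (divisor_summatory M)" by (simp add: divisor_summatory_eq)
  finally show ?thesis .
qed

text \<open>The index \<open>N\<close> of an eigenvalue \<open>M\<^sup>2\<close> lies between two consecutive values of the divisor summatory
function, whatever its position within the eigenspace.\<close>

lemma index_vs_frequency:
  assumes "M \<ge> 1" "divisor_summatory (M - 1) \<le> N" "N \<le> divisor_summatory M"
  shows "\<bar>real N - real M * ln (real M)\<bar> \<le> 2 * real M"
proof -
  have "real N \<le> real M * ln (real M) + real M"
    using divisor_summatory_upper[OF assms(1)] assms(3) by linarith
  moreover have "real N \<ge> (real M - 1) * ln (real M) - (real M - 1)"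
    using divisor_summatory_lower[of "M - 1"] assms(1,2) by (simp add: of_nat_diff)
  then have "real N \<ge> real M * ln (real M) - ln (real M) - real M + 1"
    by (simp add: left_diff_distrib)
  moreover have "ln (real M) \<le> real M - 1" using assms(1) by (intro ln_le_minus_one) simp
  ultimately show ?thesis using assms(1) by (simp add: abs_le_iff)
qed

text \<open>Changing the argument of the logarithm from \<open>s\<close> to \<open>t\<close> moves \<open>s ln s\<close> towards \<open>t ln t\<close>. This
inverts \<open>s \<mapsto> s ln s\<close> quantitatively: an error of order \<open>t\<close> in the value costs only the factor
\<open>1 / ln t\<close> in the relative error of the argument.\<close>

lemma x_ln_x_gap:
  fixes s t :: real
  assumes "s > 0" "t \<ge> 1"
  shows "\<bar>s - t\<bar> * ln t \<le> \<bar>s * ln s - t * ln t\<bar>"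
proof (cases "s \<ge> t")
  case True
  then have "s * ln t \<le> s * ln s" using assms by (intro mult_left_mono) auto
  with True show ?thesis by (simp add: left_diff_distrib)
next
  case False
  then have "s * ln s \<le> s * ln t" using assms by (intro mult_left_mono) auto
  with False show ?thesis by (simp add: left_diff_distrib)
qed

lemma ratio_tendsto_1:
  fixes s t :: "nat \<Rightarrow> real"
  assumes t: "filterlim t at_top sequentially"
    and s: "eventually (\<lambda>N. s N > 0) sequentially"
    and close: "eventually (\<lambda>N. \<bar>s N * ln (s N) - t N * ln (t N)\<bar> \<le> C * t N) sequentially"
  shows "(\<lambda>N. t N / s N) \<longlonglongrightarrow> 1"
proof -
  have lim: "(\<lambda>N. C / ln (t N)) \<longlonglongrightarrow> 0"
    by (intro tendsto_divide_0[OF tendsto_const] filterlim_at_top_imp_at_infinity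
        filterlim_compose[OF ln_at_top t])
  have "eventually (\<lambda>N. t N \<ge> 2) sequentially"
    using t by (simp add: filterlim_at_top)
  with s close have "eventually (\<lambda>N. \<bar>s N / t N - 1\<bar> \<le> C / ln (t N)) sequentially"
  proof eventually_elim
    case (elim N)
    then have "\<bar>s N - t N\<bar> * ln (t N) \<le> C * t N"
      using x_ln_x_gap[of "s N" "t N"] by linarith
    moreover have "\<bar>s N / t N - 1\<bar> = \<bar>s N - t N\<bar> / t N"
    proof -
      have "s N / t N - 1 = (s N - t N) / t N" using elim by (simp add: diff_divide_distrib)
      then show ?thesis using elim by (simp add: abs_divide)
    qed
    moreover have "ln (t N) > 0" "t N > 0" using elim by auto
    ultimately show ?case by (simp add: field_simps)
  qed
  then have "(\<lambda>N. s N / t N - 1) \<longlonglongrightarrow> 0"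
    by (intro Lim_null_comparison[OF _ lim]) simp
  then have "(\<lambda>N. s N / t N) \<longlonglongrightarrow> 1" by (simp add: LIM_zero_iff)
  from tendsto_inverse[OF this] show ?thesis by simp
qed

lemma lambda_of_sqrt:
  "sqrt (lambda_of N) > 0" "sqrt (lambda_of N) * ln (sqrt (lambda_of N)) = real N"
proof -
  have "lambda_of N > 0 \<and> real N = sqrt (lambda_of N) / 2 * ln (lambda_of N)"
    unfolding lambda_of_def by (rule theI'[OF lambda_of_ex1])
  then show "sqrt (lambda_of N) > 0" "sqrt (lambda_of N) * ln (sqrt (lambda_of N)) = real N"
    by (simp_all add: ln_sqrt)
qed

section \<open>Mean values of squared sines\<close>

text \<open>The squares of the sines average to one half with bounded total error, because
\<open>4 sin \<theta> ((sin (k \<theta>))\<^sup>2 - 1/2)\<close> telescopes.\<close>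

lemma sum_sin_squared:
  fixes \<theta> :: real
  assumes "sin \<theta> \<noteq> 0"
  shows "\<bar>(\<Sum>k=1..L. (sin (real k * \<theta>))\<^sup>2) - real L / 2\<bar> \<le> 1 / (2 * \<bar>sin \<theta>\<bar>)"
proof -
  have "4 * sin \<theta> * ((\<Sum>k=1..L. (sin (real k * \<theta>))\<^sup>2) - real L / 2)
      = sin \<theta> - sin ((2 * real L + 1) * \<theta>)"
  proof (induction L)
    case (Suc L)
    define \<phi> where "\<phi> = real (Suc L) * \<theta>"
    have e: "(2 * real L + 1) * \<theta> = 2 * \<phi> - \<theta>" "(2 * real (Suc L) + 1) * \<theta> = 2 * \<phi> + \<theta>"
      by (simp_all add: \<phi>_def algebra_simps)
    have "4 * sin \<theta> * (sin \<phi>)\<^sup>2 - 2 * sin \<theta> = - 2 * sin \<theta> * cos (2 * \<phi>)"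
      unfolding cos_double_sin by (simp add: algebra_simps)
    also have "\<dots> = sin (2 * \<phi> - \<theta>) - sin (2 * \<phi> + \<theta>)"
      by (simp add: sin_diff sin_add)
    finally have "4 * sin \<theta> * (sin \<phi>)\<^sup>2 - 2 * sin \<theta> = sin (2 * \<phi> - \<theta>) - sin (2 * \<phi> + \<theta>)" .
    note step = this
    define X where "X = (\<Sum>k=1..L. (sin (real k * \<theta>))\<^sup>2)"
    have "(\<Sum>k=1..Suc L. (sin (real k * \<theta>))\<^sup>2) = X + (sin \<phi>)\<^sup>2"
      by (simp add: X_def \<phi>_def)
    then have "4 * sin \<theta> * ((\<Sum>k=1..Suc L. (sin (real k * \<theta>))\<^sup>2) - real (Suc L) / 2)
        = 4 * sin \<theta> * (X - real L / 2) + (4 * sin \<theta> * (sin \<phi>)\<^sup>2 - 2 * sin \<theta>)"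
      by (simp add: algebra_simps)
    also have "4 * sin \<theta> * (X - real L / 2) = sin \<theta> - sin (2 * \<phi> - \<theta>)"
      using Suc.IH unfolding e X_def .
    finally show ?case unfolding e step by simp
  qed simp
  then have "4 * \<bar>sin \<theta>\<bar> * \<bar>(\<Sum>k=1..L. (sin (real k * \<theta>))\<^sup>2) - real L / 2\<bar>
      = \<bar>sin \<theta> - sin ((2 * real L + 1) * \<theta>)\<bar>"
    by (metis abs_mult abs_numeral)
  also have "\<dots> \<le> 2"
    using abs_sin_le_one[of \<theta>] abs_sin_le_one[of "(2 * real L + 1) * \<theta>"] by linarith
  finally show ?thesis using assms by (simp add: field_simps)
qed

text \<open>Only every \<open>j\<close>-th frequency occurs on the \<open>j\<close>-th edge, but there each eigenfunction carries the
normalisation \<open>2 j / pi\<close>; with the mean value one half of the sine squares, the dependence on \<open>j\<close>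
cancels in the leading term.\<close>

lemma edge_density_sum:
  fixes y :: real
  assumes "j \<ge> 1" "sin (real j * y) \<noteq> 0"
  shows "\<bar>(\<Sum>m=1..M. if j dvd m then 2 * real j / pi * (sin (real m * y))\<^sup>2 else 0) - real M / pi\<bar>
    \<le> real j / pi * (1 / \<bar>sin (real j * y)\<bar> + 1)"
proof -
  let ?L = "M div j"
  define A where "A = (\<Sum>k=1..?L. (sin (real k * (real j * y)))\<^sup>2)"
  \<comment> \<open>oscillation of the sines, and the rounding in \<open>M div j\<close>\<close>
  define E where "E = 2 * real j / pi * (A - real ?L / 2)"
  define R where "R = (real M - real j * real ?L) / pi"
  have "(\<Sum>m=1..M. if j dvd m then 2 * real j / pi * (sin (real m * y))\<^sup>2 else 0) = 2 * real j / pi * A"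
    unfolding A_def by (subst sum_over_multiples[OF assms(1)]) (simp add: sum_distrib_left mult_ac)
  also have "2 * real j / pi * A = real M / pi + (E - R)"
    by (simp add: E_def R_def field_simps)
  finally have "(\<Sum>m=1..M. if j dvd m then 2 * real j / pi * (sin (real m * y))\<^sup>2 else 0) - real M / pi = E - R"
    by simp
  moreover have "\<bar>E\<bar> \<le> real j / pi * (1 / \<bar>sin (real j * y)\<bar>)"
  proof -
    have "\<bar>E\<bar> = 2 * real j / pi * \<bar>A - real ?L / 2\<bar>"
      by (simp add: E_def abs_mult)
    also have "\<dots> \<le> 2 * real j / pi * (1 / (2 * \<bar>sin (real j * y)\<bar>))"
      unfolding A_def by (intro mult_left_mono sum_sin_squared assms) simp
    finally show ?thesis by simp
  qed
  moreover have "\<bar>R\<bar> \<le> real j / pi"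
  proof -
    have "real M - real j * real ?L = real (M mod j)"
      by (simp add: minus_mult_div_eq_mod flip: of_nat_mult of_nat_diff)
    moreover have "real (M mod j) \<le> real j" using assms(1) by (simp add: less_imp_le)
    ultimately show ?thesis by (simp add: R_def divide_right_mono)
  qed
  ultimately show ?thesis using abs_triangle_ineq4[of E R] by (simp add: distrib_left)
qed

section \<open>The local Weyl law\<close>

context edge_mode_basis
begin

lemma sum_up_to_frequency:
  fixes g :: "nat \<Rightarrow> 'b::comm_monoid_add"
  shows "sum g {n. n \<ge> 1 \<and> freq n \<le> M} = (\<Sum>m=1..M. sum g (level m))"
proof -
  have "{n. n \<ge> 1 \<and> freq n \<le> M} = (\<Union>m\<in>{1..M}. level m)"
    using freq_pos by (auto simp: level_def)
  then show ?thesis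
    by (simp only:) (rule sum.UNION_disjoint, use finite_level in \<open>auto simp: level_def\<close>)
qed

lemma finite_up_to_frequency: "finite {n. n \<ge> 1 \<and> freq n \<le> M}"
proof -
  have "{n. n \<ge> 1 \<and> freq n \<le> M} \<subseteq> (\<Union>m\<in>{1..M}. level m)"
    using freq_pos by (auto simp: level_def)
  moreover have "finite (\<Union>m\<in>{1..M}. level m)" using finite_level by simp
  ultimately show ?thesis by (rule finite_subset)
qed

lemma card_up_to_frequency: "card {n. n \<ge> 1 \<and> freq n \<le> M} = divisor_summatory M"
proof -
  have "card {n. n \<ge> 1 \<and> freq n \<le> M} = (\<Sum>m=1..M. card (level m))"
    using sum_up_to_frequency[of "\<lambda>_. 1::nat" M] by simp
  also have "\<dots> = divisor_summatory M"
    unfolding divisor_summatory_def by (rule sum.cong) (use card_level in auto)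
  finally show ?thesis .
qed

text \<open>Since the frequencies are monotone, the first \<open>N\<close> eigenfunctions exhaust all levels below \<open>freq N\<close> and
reach none above it; only the last level may be cut, at an arbitrary place.\<close>

lemma initial_segment_between:
  assumes "N \<ge> 1"
  shows "{n. n \<ge> 1 \<and> freq n \<le> freq N - 1} \<subseteq> {1..N}" "{1..N} \<subseteq> {n. n \<ge> 1 \<and> freq n \<le> freq N}"
proof -
  show "{n. n \<ge> 1 \<and> freq n \<le> freq N - 1} \<subseteq> {1..N}"
  proof
    fix n assume "n \<in> {n. n \<ge> 1 \<and> freq n \<le> freq N - 1}"
    then have "n \<ge> 1" "freq n < freq N" using freq_pos[OF assms] by auto
    then show "n \<in> {1..N}" using freq_mono[OF assms, of n] by (cases "n \<le> N") auto
  qed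
  show "{1..N} \<subseteq> {n. n \<ge> 1 \<and> freq n \<le> freq N}" using freq_mono by auto
qed

lemma index_between_divisor_summatory:
  assumes "N \<ge> 1"
  shows "divisor_summatory (freq N - 1) \<le> N" "N \<le> divisor_summatory (freq N)"
proof -
  have "card {n. n \<ge> 1 \<and> freq n \<le> freq N - 1} \<le> card {1..N}"
    by (intro card_mono initial_segment_between assms) simp
  then show "divisor_summatory (freq N - 1) \<le> N" unfolding card_up_to_frequency by simp
  have "card {1..N} \<le> card {n. n \<ge> 1 \<and> freq n \<le> freq N}"
    by (intro card_mono initial_segment_between assms finite_up_to_frequency)
  then show "N \<le> divisor_summatory (freq N)" unfolding card_up_to_frequency by simp
qed

lemma freq_at_top: "filterlim freq at_top sequentially"
  unfolding filterlim_at_top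
proof
  fix K
  have "K \<le> freq N" if "N \<ge> Suc (divisor_summatory K)" for N
  proof (rule ccontr)
    assume "\<not> K \<le> freq N"
    then have "divisor_summatory (freq N) \<le> divisor_summatory K"
      by (intro divisor_summatory_mono) simp
    then show False using index_between_divisor_summatory(2)[of N] that by simp
  qed
  then show "eventually (\<lambda>N. K \<le> freq N) sequentially"
    unfolding eventually_sequentially by blast
qed

text \<open>Both \<open>sqrt (lambda_of N)\<close> and \<open>freq N\<close> solve \<open>s ln s = N\<close>, the first exactly and the second up to
\<open>O(freq N)\<close>.\<close>

lemma freq_over_sqrt_lambda: "(\<lambda>N. real (freq N) / sqrt (lambda_of N)) \<longlonglongrightarrow> 1"
proof (rule ratio_tendsto_1)
  show "filterlim (\<lambda>N. real (freq N)) at_top sequentially"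
    by (rule filterlim_compose[OF filterlim_real_sequentially freq_at_top])
  show "eventually (\<lambda>N. sqrt (lambda_of N) > 0) sequentially"
    by (intro always_eventually allI lambda_of_sqrt)
  show "eventually (\<lambda>N. \<bar>sqrt (lambda_of N) * ln (sqrt (lambda_of N)) - real (freq N) * ln (real (freq N))\<bar>
      \<le> 2 * real (freq N)) sequentially"
    using eventually_ge_at_top[of 1]
  proof eventually_elim
    case (elim N)
    show ?case
      unfolding lambda_of_sqrt(2)
      by (rule index_vs_frequency) (use elim freq_pos index_between_divisor_summatory in auto)
  qed
qed

text \<open>The sum is trapped between its values for the full levels up to \<open>freq N - 1\<close> and up to \<open>freq N\<close>, so
cutting the last level costs only a bounded error.\<close>

lemma square_sum_close_to_freq:
  assumes j: "j \<ge> 1" and x: "vertex (j - 1) < x" "x < vertex j"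
  obtains C where "\<And>N. N \<ge> 1 \<Longrightarrow> \<bar>(\<Sum>n=1..N. (cmod (f n x))\<^sup>2) - real (freq N) / pi\<bar> \<le> C"
proof -
  let ?y = "x - vertex (j - 1)"
  define T where "T = (\<lambda>M. \<Sum>n | n \<ge> 1 \<and> freq n \<le> M. (cmod (f n x))\<^sup>2)"
  define C where "C = real j / pi * (1 / \<bar>sin (real j * ?y)\<bar> + 1)"
  have "0 < real j * ?y" "real j * ?y < pi"
    using j x vertex_pred[OF j] by (simp_all add: field_simps)
  then have "sin (real j * ?y) \<noteq> 0" using sin_gt_zero by fastforce
  have T: "\<bar>T M - real M / pi\<bar> \<le> C" for M
  proof -
    have "T M = (\<Sum>m=1..M. \<Sum>n\<in>level m. (cmod (f n x))\<^sup>2)"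
      unfolding T_def by (rule sum_up_to_frequency)
    also have "\<dots> = (\<Sum>m=1..M. if j dvd m then 2 * real j / pi * (sin (real m * ?y))\<^sup>2 else 0)"
      by (rule sum.cong[OF refl], rule level_square_sum) (use j x in auto)
    finally show ?thesis
      unfolding C_def using edge_density_sum[OF j \<open>sin (real j * ?y) \<noteq> 0\<close>] by simp
  qed
  have "\<bar>(\<Sum>n=1..N. (cmod (f n x))\<^sup>2) - real (freq N) / pi\<bar> \<le> C + 1 / pi" if "N \<ge> 1" for N
  proof -
    let ?S = "\<Sum>n=1..N. (cmod (f n x))\<^sup>2"
    have "T (freq N - 1) \<le> ?S"
      unfolding T_def by (rule sum_mono2) (use initial_segment_between[OF that] in auto)
    moreover have "?S \<le> T (freq N)"
      unfolding T_def
      by (rule sum_mono2[OF finite_up_to_frequency]) (use initial_segment_between[OF that] in auto)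
    \<comment> \<open>truncated subtraction is exact here because frequencies are positive\<close>
    moreover have "real (freq N - 1) / pi = real (freq N) / pi - 1 / pi"
      using freq_pos[OF that] by (simp add: of_nat_diff diff_divide_distrib)
    moreover have "1 / pi > 0" by simp
    ultimately show ?thesis using T[of "freq N - 1"] T[of "freq N"] unfolding abs_le_iff by linarith
  qed
  then show ?thesis by (rule that)
qed

lemma local_weyl_law:
  assumes "j \<ge> 1" "vertex (j - 1) < x" "x < vertex j"
  shows "(\<lambda>N. 1 / sqrt (lambda_of N) * (\<Sum>n=1..N. (cmod (f n x))\<^sup>2)) \<longlonglongrightarrow> 1 / pi"
proof -
  let ?S = "\<lambda>N. \<Sum>n=1..N. (cmod (f n x))\<^sup>2"
  obtain C where C: "\<And>N. N \<ge> 1 \<Longrightarrow> \<bar>?S N - real (freq N) / pi\<bar> \<le> C"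
    using square_sum_close_to_freq[OF assms] by blast
  have "filterlim (\<lambda>N. real (freq N)) at_top sequentially"
    by (rule filterlim_compose[OF filterlim_real_sequentially freq_at_top])
  then have "(\<lambda>N. C / real (freq N)) \<longlonglongrightarrow> 0"
    by (intro tendsto_divide_0[OF tendsto_const] filterlim_at_top_imp_at_infinity)
  moreover have "eventually (\<lambda>N. norm (?S N / real (freq N) - 1 / pi) \<le> C / real (freq N)) sequentially"
    using eventually_ge_at_top[of 1]
  proof eventually_elim
    case (elim N)
    then have "real (freq N) > 0" using freq_pos by (simp add: Suc_le_eq)
    then have "?S N / real (freq N) - 1 / pi = (?S N - real (freq N) / pi) / real (freq N)"
      by (simp add: diff_divide_distrib)
    then show ?case
      using C[OF elim] \<open>real (freq N) > 0\<close> by (simp add: abs_divide divide_right_mono del: of_nat_0_less_iff)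
  qed
  ultimately have "(\<lambda>N. ?S N / real (freq N) - 1 / pi) \<longlonglongrightarrow> 0"
    by (rule Lim_null_comparison[rotated])
  then have "(\<lambda>N. ?S N / real (freq N)) \<longlonglongrightarrow> 1 / pi" by (simp only: LIM_zero_iff)
  from tendsto_mult[OF this freq_over_sqrt_lambda]
  have "(\<lambda>N. ?S N / real (freq N) * (real (freq N) / sqrt (lambda_of N))) \<longlonglongrightarrow> 1 / pi" by simp
  then show ?thesis
  proof (rule Lim_transform_eventually)
    show "eventually (\<lambda>N. ?S N / real (freq N) * (real (freq N) / sqrt (lambda_of N))
        = 1 / sqrt (lambda_of N) * ?S N) sequentially"
      using eventually_ge_at_top[of 1]
    proof eventually_elim
      case (elim N)
      then have "real (freq N) \<noteq> 0" using freq_pos[OF elim] by simp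
      then show ?case by simp
    qed
  qed
qed

end

text \<open>A basis function cannot vanish on the whole half-line because it has norm 1, so the description of
nonzero eigenfunctions applies to each of them.\<close>

lemma ordered_eigenbasis_edge_mode_basis:
  assumes "ordered_eigenbasis_H_infinity ev f"
  shows "\<exists>freq coef. edge_mode_basis f freq coef"
proof -
  have basis: "orthonormal_basis_L2 {0..} f"
    and mono: "\<And>m n. 1 \<le> m \<Longrightarrow> m \<le> n \<Longrightarrow> ev m \<le> ev n"
    and H: "\<And>n. n \<ge> 1 \<Longrightarrow> H_infinity (f n) (\<lambda>x. of_real (ev n) * f n x)"
    using assms by (auto simp: ordered_eigenbasis_H_infinity_def mono_on_def)
  have "\<exists>m c. m \<ge> 1 \<and> ev n = (real m)\<^sup>2 \<and>
      (\<forall>x\<ge>0. f n x = (\<Sum>j | j dvd m. c j * edge_mode j m x))" if "n \<ge> 1" for n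
  proof (rule H_infinity_eigenfunction[OF H[OF that]], rule ccontr)
    assume "\<not> (\<exists>x\<ge>0. f n x \<noteq> 0)"
    then have "L2_inner {0..} (f n) (f n) = L2_inner {0..} (\<lambda>_. 0) (\<lambda>_. 0)"
      by (intro L2_inner_cong) auto
    moreover have "L2_inner {0..} (f n) (f n) = 1"
      using basis that by (auto simp: orthonormal_basis_L2_def)
    ultimately show False by (simp add: L2_inner_def)
  qed
  then obtain freq coef where fc: "\<And>n. n \<ge> 1 \<Longrightarrow> freq n \<ge> 1" "\<And>n. n \<ge> 1 \<Longrightarrow> ev n = (real (freq n))\<^sup>2"
    "\<And>n x. n \<ge> 1 \<Longrightarrow> x \<ge> 0 \<Longrightarrow> f n x = (\<Sum>j | j dvd freq n. coef n j * edge_mode j (freq n) x)"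
    by metis
  have "edge_mode_basis f freq coef"
  proof
    fix m n :: nat assume mn: "1 \<le> m" "m \<le> n"
    then have "(real (freq m))\<^sup>2 \<le> (real (freq n))\<^sup>2"
      using mono[OF mn] fc(2)[of m] fc(2)[of n] by simp
    then show "freq m \<le> freq n" using power2_le_imp_le of_nat_le_iff of_nat_0_le_iff by blast
  qed (use basis fc in auto)
  then show ?thesis by blast
qed

theorem theorem11:
  fixes ev :: "nat \<Rightarrow> real" and f :: "nat \<Rightarrow> real \<Rightarrow> complex"
  assumes "ordered_eigenbasis_H_infinity ev f"
  shows "(\<forall>x>0. (\<forall>n\<ge>1. x \<noteq> vertex n) \<longrightarrow>
            (\<lambda>N. 1 / sqrt (lambda_of N) * (\<Sum>n=1..N. (cmod (f n x))\<^sup>2)) \<longlonglongrightarrow> 1 / pi)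
       \<and> (\<forall>k\<ge>1. \<forall>N. (\<Sum>n=1..N. (cmod (f n (vertex k)))\<^sup>2) = 0)"
proof (intro conjI allI impI)
  fix x :: real assume x: "x > 0" "\<forall>n\<ge>1. x \<noteq> vertex n"
  obtain freq coef where "edge_mode_basis f freq coef"
    using ordered_eigenbasis_edge_mode_basis[OF assms] by blast
  then interpret edge_mode_basis f freq coef .
  obtain j where j: "j \<ge> 1" "vertex (j - 1) \<le> x" "x < vertex j"
    using edge_containing[of x] x(1) by auto
  \<comment> \<open>for \<open>j = 1\<close> the left end is 0, which is excluded by \<open>x > 0\<close> rather than as a vertex\<close>
  have "vertex (j - 1) \<noteq> x" using x by (cases "j - 1") auto
  with j show "(\<lambda>N. 1 / sqrt (lambda_of N) * (\<Sum>n=1..N. (cmod (f n x))\<^sup>2)) \<longlonglongrightarrow> 1 / pi"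
    by (intro local_weyl_law) auto
next
  fix k N :: nat assume "k \<ge> 1"
  have "f n (vertex k) = 0" if "n \<ge> 1" for n
    using assms that \<open>k \<ge> 1\<close>
    by (auto simp: ordered_eigenbasis_H_infinity_def H_infinity_def dirichlet_laplacian_def)
  then show "(\<Sum>n=1..N. (cmod (f n (vertex k)))\<^sup>2) = 0" by simp
qed

end
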